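(* Let $L$ be the Fra\"iss\'e limit of the class of all finite nontrivial Heyting algebras. Then the group $\mathrm{Aut}(L)$ is simple. In fact, for any nontrivial $g\in\mathrm{Aut}(L)$, every element of $\mathrm{Aut}(L)$ is the product of at most $16$ conjugates of $g$ and $g^{-1}$.
   Context: Heyting algebras are structures in the language $\{0,1,\wedge,\vee,\to\}$; nontrivial means $0\neq 1$. The Fra\"iss\'e limit $L$ is the (unique up to isomorphism) countable Heyting algebra that is ultrahomogeneous (every isomorphism between finitely generated substructures of $L$ extends to an automorphism of $L$) and whose finitely generated substructures are, up to isomorphism, exactly the finite nontrivial Heyting algebras. It is known to exist. Simplicity is that of $\mathrm{Aut}(L)$ as an abstract group. *)

theory Defs
  imports "HOL-Algebra.Bij" "HOL-Algebra.SimpleGroups" "HOL-Library.Countable_Set"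
begin

record 'a heyting = "'a partial_object" +
  hbot :: 'a ("\<^bold>0\<index>")
  htop :: 'a ("\<^bold>1\<index>")
  hmeet :: "['a, 'a] \<Rightarrow> 'a" (infixl "\<^bold>\<and>\<index>" 70)
  hjoin :: "['a, 'a] \<Rightarrow> 'a" (infixl "\<^bold>\<or>\<index>" 65)
  himp :: "['a, 'a] \<Rightarrow> 'a" (infixr "\<^bold>\<rightarrow>\<index>" 60)

text \<open>
  A bounded lattice, given by its identities, in which \<open>a \<^bold>\<rightarrow> b\<close> is the largest \<open>c\<close>
  with \<open>c \<^bold>\<and> a \<le> b\<close>; here \<open>x \<le> y\<close> is written as \<open>x \<^bold>\<and> y = x\<close>.
  Distributivity is a consequence.  The one-element algebra is allowed.
\<close>

locale heyting_algebra =
  fixes H :: "'a heyting" (structure)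
  assumes bot_closed: "\<^bold>0 \<in> carrier H"
    and top_closed: "\<^bold>1 \<in> carrier H"
    and meet_closed: "\<lbrakk>a \<in> carrier H; b \<in> carrier H\<rbrakk> \<Longrightarrow> a \<^bold>\<and> b \<in> carrier H"
    and join_closed: "\<lbrakk>a \<in> carrier H; b \<in> carrier H\<rbrakk> \<Longrightarrow> a \<^bold>\<or> b \<in> carrier H"
    and imp_closed: "\<lbrakk>a \<in> carrier H; b \<in> carrier H\<rbrakk> \<Longrightarrow> a \<^bold>\<rightarrow> b \<in> carrier H"
    and meet_comm: "\<lbrakk>a \<in> carrier H; b \<in> carrier H\<rbrakk> \<Longrightarrow> a \<^bold>\<and> b = b \<^bold>\<and> a"
    and join_comm: "\<lbrakk>a \<in> carrier H; b \<in> carrier H\<rbrakk> \<Longrightarrow> a \<^bold>\<or> b = b \<^bold>\<or> a"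
    and meet_assoc: "\<lbrakk>a \<in> carrier H; b \<in> carrier H; c \<in> carrier H\<rbrakk>
      \<Longrightarrow> (a \<^bold>\<and> b) \<^bold>\<and> c = a \<^bold>\<and> (b \<^bold>\<and> c)"
    and join_assoc: "\<lbrakk>a \<in> carrier H; b \<in> carrier H; c \<in> carrier H\<rbrakk>
      \<Longrightarrow> (a \<^bold>\<or> b) \<^bold>\<or> c = a \<^bold>\<or> (b \<^bold>\<or> c)"
    and meet_absorb: "\<lbrakk>a \<in> carrier H; b \<in> carrier H\<rbrakk> \<Longrightarrow> a \<^bold>\<and> (a \<^bold>\<or> b) = a"
    and join_absorb: "\<lbrakk>a \<in> carrier H; b \<in> carrier H\<rbrakk> \<Longrightarrow> a \<^bold>\<or> (a \<^bold>\<and> b) = a"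
    and bot_least: "a \<in> carrier H \<Longrightarrow> \<^bold>0 \<^bold>\<and> a = \<^bold>0"
    and top_greatest: "a \<in> carrier H \<Longrightarrow> a \<^bold>\<and> \<^bold>1 = a"
    and residuation: "\<lbrakk>a \<in> carrier H; b \<in> carrier H; c \<in> carrier H\<rbrakk>
      \<Longrightarrow> (c \<^bold>\<and> a) \<^bold>\<and> b = c \<^bold>\<and> a \<longleftrightarrow> c \<^bold>\<and> (a \<^bold>\<rightarrow> b) = c"

definition finite_nontrivial_heyting :: "'a heyting \<Rightarrow> bool" where
  "finite_nontrivial_heyting H \<longleftrightarrow>
     heyting_algebra H \<and> finite (carrier H) \<and> hbot H \<noteq> htop H"

definition heyting_iso :: "'a heyting \<Rightarrow> 'b heyting \<Rightarrow> ('a \<Rightarrow> 'b) set" where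
  "heyting_iso A B = {f. bij_betw f (carrier A) (carrier B)
     \<and> f \<^bold>0\<^bsub>A\<^esub> = \<^bold>0\<^bsub>B\<^esub> \<and> f \<^bold>1\<^bsub>A\<^esub> = \<^bold>1\<^bsub>B\<^esub>
     \<and> (\<forall>x\<in>carrier A. \<forall>y\<in>carrier A.
          f (x \<^bold>\<and>\<^bsub>A\<^esub> y) = f x \<^bold>\<and>\<^bsub>B\<^esub> f y
        \<and> f (x \<^bold>\<or>\<^bsub>A\<^esub> y) = f x \<^bold>\<or>\<^bsub>B\<^esub> f y
        \<and> f (x \<^bold>\<rightarrow>\<^bsub>A\<^esub> y) = f x \<^bold>\<rightarrow>\<^bsub>B\<^esub> f y)}"

definition subuniverse :: "'a heyting \<Rightarrow> 'a set \<Rightarrow> bool" where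
  "subuniverse H S \<longleftrightarrow> S \<subseteq> carrier H \<and> \<^bold>0\<^bsub>H\<^esub> \<in> S \<and> \<^bold>1\<^bsub>H\<^esub> \<in> S
     \<and> (\<forall>x\<in>S. \<forall>y\<in>S. x \<^bold>\<and>\<^bsub>H\<^esub> y \<in> S \<and> x \<^bold>\<or>\<^bsub>H\<^esub> y \<in> S \<and> x \<^bold>\<rightarrow>\<^bsub>H\<^esub> y \<in> S)"

definition generated_subuniverse :: "'a heyting \<Rightarrow> 'a set \<Rightarrow> 'a set" where
  "generated_subuniverse H X = \<Inter>{S. subuniverse H S \<and> X \<subseteq> S}"

definition fg_substructures :: "'a heyting \<Rightarrow> 'a heyting set" where
  "fg_substructures H =
     {H\<lparr>carrier := generated_subuniverse H X\<rparr> | X. finite X \<and> X \<subseteq> carrier H}"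

text \<open>
  Automorphisms are extensional functions (value \<open>undefined\<close> off the carrier), as in
  \<^const>\<open>AutoGroup\<close>, so that distinct group elements are distinct automorphisms.
\<close>

definition heyting_auto :: "'a heyting \<Rightarrow> ('a \<Rightarrow> 'a) set" where
  "heyting_auto H = heyting_iso H H \<inter> Bij (carrier H)"

definition heyting_Aut :: "'a heyting \<Rightarrow> ('a \<Rightarrow> 'a) monoid" where
  "heyting_Aut H = BijGroup (carrier H) \<lparr>carrier := heyting_auto H\<rparr>"

definition ultrahomogeneous :: "'a heyting \<Rightarrow> bool" where
  "ultrahomogeneous L \<longleftrightarrow>
     (\<forall>A\<in>fg_substructures L. \<forall>B\<in>fg_substructures L. \<forall>f\<in>heyting_iso A B.
        \<exists>g\<in>heyting_auto L. \<forall>x\<in>carrier A. g x = f x)"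

text \<open>
  In the last clause it suffices to let \<open>A\<close> range over algebras whose carrier is a set of
  natural numbers, since every finite algebra is isomorphic to one of these.
\<close>

definition heyting_fraisse_limit :: "'a heyting \<Rightarrow> bool" where
  "heyting_fraisse_limit L \<longleftrightarrow>
     heyting_algebra L \<and> countable (carrier L) \<and> ultrahomogeneous L
     \<and> (\<forall>B\<in>fg_substructures L. finite_nontrivial_heyting B)
     \<and> (\<forall>A :: nat heyting. finite_nontrivial_heyting A \<longrightarrow>
          (\<exists>B\<in>fg_substructures L. heyting_iso A B \<noteq> {}))"

text \<open>
  The library's \<^locale>\<open>simple_group\<close> demands \<open>order G > 1\<close>, which fails for every
  infinite group because the cardinality of an infinite set is \<open>0\<close>; it is therefore
  not usable here.
\<close>

definition abstract_simple_group :: "('a, 'b) monoid_scheme \<Rightarrow> bool" where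
  "abstract_simple_group G \<longleftrightarrow>
     group G \<and> carrier G \<noteq> {\<one>\<^bsub>G\<^esub>}
     \<and> (\<forall>N. N \<lhd> G \<longrightarrow> N = carrier G \<or> N = {\<one>\<^bsub>G\<^esub>})"

definition conjugates :: "('a, 'b) monoid_scheme \<Rightarrow> 'a \<Rightarrow> 'a set" where
  "conjugates G g = {k \<otimes>\<^bsub>G\<^esub> g \<otimes>\<^bsub>G\<^esub> inv\<^bsub>G\<^esub> k | k. k \<in> carrier G}"

definition product_of_at_most :: "('a, 'b) monoid_scheme \<Rightarrow> nat \<Rightarrow> 'a set \<Rightarrow> 'a \<Rightarrow> bool" where
  "product_of_at_most G n C h \<longleftrightarrow>
     (\<exists>cs. length cs \<le> n \<and> set cs \<subseteq> C \<and> h = foldr (\<otimes>\<^bsub>G\<^esub>) cs \<one>\<^bsub>G\<^esub>)"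

end

theory Submission
  imports Defs
begin

text \<open>
  In the Fraisse limit \<open>L\<close> there is, for all \<open>a\<close> not below \<open>b\<close>, a complemented element \<open>c \<le> a\<close>
  not below \<open>b\<close>: embed the finite subalgebra \<open>A\<close> generated by \<open>a, b\<close> into \<open>A \<times> [0, a]\<close> by
  \<open>x \<mapsto> (x, x \<and> a)\<close> and take \<open>c = (0, a)\<close>.  So every \<open>g \<noteq> 1\<close> moves some complemented
  \<open>c \<noteq> 0\<close> off itself.  By countability there are complemented elements
  \<open>c = d\<^sub>0 > d\<^sub>1 > \<dots>\<close> converging to a point, in the sense that every element of \<open>L\<close> lies above
  or is disjoint from some \<open>d\<^sub>n\<close>; automorphisms supported on the layers \<open>d\<^sub>n - d\<^sub>n\<^sub>+\<^sub>1\<close> can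
  then be multiplied together infinitely often.  As in Anderson's argument for homeomorphisms of the
  Cantor set, every \<open>f\<close> supported on \<open>d\<^sub>0 - d\<^sub>1\<close> is a commutator \<open>[F, s]\<close> with \<open>F, s\<close> supported
  on \<open>c\<close>, and since \<open>c\<close> and \<open>g c\<close> are disjoint, \<open>f = [[F, g], s]\<close> is a product of four conjugates
  of \<open>g\<close> and its inverse.  All complemented elements other than \<open>0, 1\<close> are conjugate, so this applies to every
  automorphism that is the identity below some complemented element \<open>\<noteq> 0\<close>, and every
  automorphism is a product of two of these.  Hence eight conjugates suffice.
\<close>

section \<open>Order and complemented elements\<close>

context heyting_algebra
begin

definition le :: "'a \<Rightarrow> 'a \<Rightarrow> bool" (infix "\<preceq>" 50) where
  "x \<preceq> y \<longleftrightarrow> x \<^bold>\<and> y = x"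

lemmas closed [simp, intro] = bot_closed top_closed meet_closed join_closed imp_closed

lemma meet_idem [simp]: "a \<in> carrier H \<Longrightarrow> a \<^bold>\<and> a = a"
  by (metis join_absorb meet_absorb meet_closed)

lemma le_refl [simp]: "a \<in> carrier H \<Longrightarrow> a \<preceq> a"
  by (simp add: le_def)

lemma le_antisym:
  "\<lbrakk>a \<preceq> b; b \<preceq> a; a \<in> carrier H; b \<in> carrier H\<rbrakk> \<Longrightarrow> a = b"
  by (metis le_def meet_comm)

lemma le_trans:
  "\<lbrakk>a \<preceq> b; b \<preceq> c; a \<in> carrier H; b \<in> carrier H; c \<in> carrier H\<rbrakk> \<Longrightarrow> a \<preceq> c"
  by (metis le_def meet_assoc)

lemma le_iff_join: "\<lbrakk>a \<in> carrier H; b \<in> carrier H\<rbrakk> \<Longrightarrow> a \<preceq> b \<longleftrightarrow> a \<^bold>\<or> b = b"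
  by (metis join_absorb join_comm le_def meet_absorb meet_comm)

lemma meet_le1 [simp]: "\<lbrakk>a \<in> carrier H; b \<in> carrier H\<rbrakk> \<Longrightarrow> a \<^bold>\<and> b \<preceq> a"
  by (metis le_def meet_assoc meet_closed meet_comm meet_idem)

lemma meet_le2 [simp]: "\<lbrakk>a \<in> carrier H; b \<in> carrier H\<rbrakk> \<Longrightarrow> a \<^bold>\<and> b \<preceq> b"
  by (metis meet_comm meet_le1)

lemma le_meet_iff [simp]:
  "\<lbrakk>a \<in> carrier H; b \<in> carrier H; c \<in> carrier H\<rbrakk> \<Longrightarrow> c \<preceq> a \<^bold>\<and> b \<longleftrightarrow> c \<preceq> a \<and> c \<preceq> b"
  by (metis le_def le_trans meet_assoc meet_closed meet_le1 meet_le2)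

lemma join_ge1 [simp]: "\<lbrakk>a \<in> carrier H; b \<in> carrier H\<rbrakk> \<Longrightarrow> a \<preceq> a \<^bold>\<or> b"
  by (simp add: le_def meet_absorb)

lemma join_ge2 [simp]: "\<lbrakk>a \<in> carrier H; b \<in> carrier H\<rbrakk> \<Longrightarrow> b \<preceq> a \<^bold>\<or> b"
  by (metis join_comm join_ge1)

lemma join_le_iff [simp]:
  "\<lbrakk>a \<in> carrier H; b \<in> carrier H; c \<in> carrier H\<rbrakk> \<Longrightarrow> a \<^bold>\<or> b \<preceq> c \<longleftrightarrow> a \<preceq> c \<and> b \<preceq> c"
  by (metis join_assoc join_closed join_ge1 join_ge2 le_iff_join le_trans)

lemma bot_le [simp]: "a \<in> carrier H \<Longrightarrow> \<^bold>0 \<preceq> a"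
  by (simp add: le_def bot_least)

lemma le_top [simp]: "a \<in> carrier H \<Longrightarrow> a \<preceq> \<^bold>1"
  by (simp add: le_def top_greatest)

lemma le_bot_iff [simp]: "a \<in> carrier H \<Longrightarrow> a \<preceq> \<^bold>0 \<longleftrightarrow> a = \<^bold>0"
  using bot_closed bot_le le_antisym by blast

lemma top_le_iff [simp]: "a \<in> carrier H \<Longrightarrow> \<^bold>1 \<preceq> a \<longleftrightarrow> a = \<^bold>1"
  using top_closed le_top le_antisym by blast

lemma imp_adjoint:
  "\<lbrakk>a \<in> carrier H; b \<in> carrier H; c \<in> carrier H\<rbrakk> \<Longrightarrow> c \<preceq> a \<^bold>\<rightarrow> b \<longleftrightarrow> c \<^bold>\<and> a \<preceq> b"
  using residuation by (simp add: le_def)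

lemma bounds_simps [simp]:
  assumes "a \<in> carrier H"
  shows "a \<^bold>\<and> \<^bold>0 = \<^bold>0" "\<^bold>0 \<^bold>\<and> a = \<^bold>0" "a \<^bold>\<and> \<^bold>1 = a" "\<^bold>1 \<^bold>\<and> a = a"
    "a \<^bold>\<or> \<^bold>0 = a" "\<^bold>0 \<^bold>\<or> a = a" "a \<^bold>\<or> \<^bold>1 = \<^bold>1" "\<^bold>1 \<^bold>\<or> a = \<^bold>1" "a \<^bold>\<or> a = a"
proof -
  show *: "\<^bold>0 \<^bold>\<and> a = \<^bold>0" "a \<^bold>\<and> \<^bold>1 = a"
    using assms by (simp_all add: bot_least top_greatest)
  show "a \<^bold>\<and> \<^bold>0 = \<^bold>0" "\<^bold>1 \<^bold>\<and> a = a"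
    using * assms meet_comm by (metis bot_closed, metis top_closed)
  show **: "\<^bold>0 \<^bold>\<or> a = a" "a \<^bold>\<or> \<^bold>1 = \<^bold>1" "a \<^bold>\<or> a = a"
    using assms by (simp_all flip: le_iff_join)
  show "a \<^bold>\<or> \<^bold>0 = a" "\<^bold>1 \<^bold>\<or> a = \<^bold>1"
    using ** assms join_comm by (metis bot_closed, metis top_closed)
qed

lemma meet_eq_left: "\<lbrakk>a \<preceq> b\<rbrakk> \<Longrightarrow> a \<^bold>\<and> b = a"
  by (simp add: le_def)

lemma meet_mono:
  "\<lbrakk>a \<preceq> a'; b \<preceq> b'; a \<in> carrier H; b \<in> carrier H; a' \<in> carrier H; b' \<in> carrier H\<rbrakk>
    \<Longrightarrow> a \<^bold>\<and> b \<preceq> a' \<^bold>\<and> b'"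
  using le_trans[OF meet_le1, of a b a'] le_trans[OF meet_le2, of a b b'] by simp

lemma join_mono:
  "\<lbrakk>a \<preceq> a'; b \<preceq> b'; a \<in> carrier H; b \<in> carrier H; a' \<in> carrier H; b' \<in> carrier H\<rbrakk>
    \<Longrightarrow> a \<^bold>\<or> b \<preceq> a' \<^bold>\<or> b'"
  using le_trans[OF _ join_ge1, of a a' b'] le_trans[OF _ join_ge2, of b b' a'] by simp

text \<open>By residuation, meeting with \<open>a\<close> is a left adjoint and so preserves joins:
  \<open>b\<close> and \<open>c\<close> lie below the same implication, hence so does their
  join.\<close>

lemma distrib:
  assumes "a \<in> carrier H" "b \<in> carrier H" "c \<in> carrier H"
  shows "a \<^bold>\<and> (b \<^bold>\<or> c) = (a \<^bold>\<and> b) \<^bold>\<or> (a \<^bold>\<and> c)"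
proof (rule le_antisym)
  have "b \<preceq> a \<^bold>\<rightarrow> (a \<^bold>\<and> b) \<^bold>\<or> (a \<^bold>\<and> c)" "c \<preceq> a \<^bold>\<rightarrow> (a \<^bold>\<and> b) \<^bold>\<or> (a \<^bold>\<and> c)"
    using assms meet_comm[of a b] meet_comm[of a c] by (simp_all add: imp_adjoint)
  then have "b \<^bold>\<or> c \<preceq> a \<^bold>\<rightarrow> (a \<^bold>\<and> b) \<^bold>\<or> (a \<^bold>\<and> c)"
    using assms by simp
  then have "(b \<^bold>\<or> c) \<^bold>\<and> a \<preceq> (a \<^bold>\<and> b) \<^bold>\<or> (a \<^bold>\<and> c)"
    using assms by (subst (asm) imp_adjoint) auto
  then show "a \<^bold>\<and> (b \<^bold>\<or> c) \<preceq> (a \<^bold>\<and> b) \<^bold>\<or> (a \<^bold>\<and> c)"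
    using assms by (metis join_closed meet_comm)
  show "(a \<^bold>\<and> b) \<^bold>\<or> (a \<^bold>\<and> c) \<preceq> a \<^bold>\<and> (b \<^bold>\<or> c)"
    using assms le_trans[OF meet_le2 join_ge1, of a b c] le_trans[OF meet_le2 join_ge2, of a c b]
    by simp
qed (use assms in auto)

lemma distrib2:
  assumes "a \<in> carrier H" "b \<in> carrier H" "c \<in> carrier H"
  shows "(b \<^bold>\<or> c) \<^bold>\<and> a = (b \<^bold>\<and> a) \<^bold>\<or> (c \<^bold>\<and> a)"
  using assms distrib by (metis join_closed meet_comm)

section \<open>Pseudocomplements and complemented elements\<close>

definition neg :: "'a \<Rightarrow> 'a" where
  "neg x = x \<^bold>\<rightarrow> \<^bold>0"

lemma neg_closed [simp, intro]: "x \<in> carrier H \<Longrightarrow> neg x \<in> carrier H"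
  by (simp add: neg_def)

lemma le_neg_iff: "\<lbrakk>x \<in> carrier H; y \<in> carrier H\<rbrakk> \<Longrightarrow> x \<preceq> neg y \<longleftrightarrow> x \<^bold>\<and> y = \<^bold>0"
  by (simp add: neg_def imp_adjoint)

lemma neg_meet [simp]: "x \<in> carrier H \<Longrightarrow> neg x \<^bold>\<and> x = \<^bold>0"
  using le_neg_iff[of "neg x" x] by simp

lemma meet_neg [simp]: "x \<in> carrier H \<Longrightarrow> x \<^bold>\<and> neg x = \<^bold>0"
  by (metis meet_comm neg_closed neg_meet)

definition complemented :: "'a set" where
  "complemented = {u \<in> carrier H. u \<^bold>\<or> neg u = \<^bold>1}"

lemma complemented_closed [simp, intro]: "u \<in> complemented \<Longrightarrow> u \<in> carrier H"
  by (simp add: complemented_def)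

lemma join_neg [simp]: "u \<in> complemented \<Longrightarrow> u \<^bold>\<or> neg u = \<^bold>1" "u \<in> complemented \<Longrightarrow> neg u \<^bold>\<or> u = \<^bold>1"
  unfolding complemented_def by (auto, metis join_comm neg_closed)

text \<open>By distributivity \<open>neg u\<close> lies below every \<open>v\<close> that joins with
  \<open>u\<close> to the top. This is the criterion by which elements are later recognised as
  complemented.\<close>

lemma complement_unique:
  assumes "u \<in> carrier H" "v \<in> carrier H" "u \<^bold>\<and> v = \<^bold>0" "u \<^bold>\<or> v = \<^bold>1"
  shows "u \<in> complemented" "neg u = v"
proof -
  have le: "v \<preceq> neg u" using assms by (metis le_neg_iff meet_comm)
  have "neg u = neg u \<^bold>\<and> (u \<^bold>\<or> v)" using assms by simp
  also have "\<dots> = neg u \<^bold>\<and> v" using distrib[of "neg u" u v] assms by simp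
  finally have "neg u \<preceq> v" unfolding le_def by (rule sym)
  then show "neg u = v" using le le_antisym assms neg_closed by blast
  then show "u \<in> complemented" using assms unfolding complemented_def by blast
qed

lemma neg_complemented [simp, intro]: "u \<in> complemented \<Longrightarrow> neg u \<in> complemented"
  and neg_neg [simp]: "u \<in> complemented \<Longrightarrow> neg (neg u) = u"
  using complement_unique[of "neg u" u] by auto

lemma complemented_decomp:
  assumes "u \<in> complemented" "x \<in> carrier H"
  shows "x = (x \<^bold>\<and> u) \<^bold>\<or> (x \<^bold>\<and> neg u)"
  using distrib[of x u "neg u"] assms by simp

lemma le_by_complemented:
  assumes "u \<in> complemented" "x \<in> carrier H" "y \<in> carrier H" "x \<^bold>\<and> u \<preceq> y" "x \<^bold>\<and> neg u \<preceq> y"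
  shows "x \<preceq> y"
  by (subst complemented_decomp[OF assms(1,2)]) (use assms in simp)

lemma bounds_complemented [simp, intro]: "\<^bold>0 \<in> complemented" "\<^bold>1 \<in> complemented" "neg \<^bold>0 = \<^bold>1" "neg \<^bold>1 = \<^bold>0"
  using complement_unique[of "\<^bold>0" "\<^bold>1"] complement_unique[of "\<^bold>1" "\<^bold>0"] by auto

lemma neg_antimono: "\<lbrakk>x \<preceq> y; x \<in> carrier H; y \<in> carrier H\<rbrakk> \<Longrightarrow> neg y \<preceq> neg x"
  using meet_mono[of "neg y" "neg y" x y] by (simp add: le_neg_iff)

lemma meet_neg_top: 
  assumes "u \<in> complemented" "x \<in> carrier H" "x \<^bold>\<and> neg u = \<^bold>0"
  shows "x \<preceq> u"
  using assms le_neg_iff[of x "neg u"] by simp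

lemma complemented_meet [simp, intro]:
  assumes "u \<in> complemented" "v \<in> complemented"
  shows "u \<^bold>\<and> v \<in> complemented" "neg (u \<^bold>\<and> v) = neg u \<^bold>\<or> neg v"
proof -
  have 1: "(u \<^bold>\<and> v) \<^bold>\<and> (neg u \<^bold>\<or> neg v) = \<^bold>0"
  proof -
    have "(u \<^bold>\<and> v) \<^bold>\<and> neg u = \<^bold>0" "(u \<^bold>\<and> v) \<^bold>\<and> neg v = \<^bold>0"
      using assms meet_mono[of "u \<^bold>\<and> v" u "neg u" "neg u"] meet_mono[of "u \<^bold>\<and> v" v "neg v" "neg v"]
      by simp_all
    then show ?thesis using assms by (simp add: distrib)
  qed
  have 2: "(u \<^bold>\<and> v) \<^bold>\<or> (neg u \<^bold>\<or> neg v) = \<^bold>1"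
  proof -
    let ?w = "(u \<^bold>\<and> v) \<^bold>\<or> (neg u \<^bold>\<or> neg v)"
    have w: "?w \<in> carrier H" using assms by simp
    have n: "neg u \<preceq> ?w" "neg v \<preceq> ?w" "u \<^bold>\<and> v \<preceq> ?w"
      using assms le_trans[OF join_ge1 join_ge2, of "neg u" "neg v" "u \<^bold>\<and> v"]
        le_trans[OF join_ge2 join_ge2, of "neg u" "neg v" "u \<^bold>\<and> v"] by simp_all
    have "u \<preceq> ?w"
      by (rule le_by_complemented[of v]) (use assms n w le_trans[OF meet_le2 n(2), of u] in auto)
    then have "\<^bold>1 \<preceq> ?w"
      by - (rule le_by_complemented[of u], use assms n w in simp_all)
    then show ?thesis using w by simp
  qed
  show "u \<^bold>\<and> v \<in> complemented" "neg (u \<^bold>\<and> v) = neg u \<^bold>\<or> neg v"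
    using complement_unique[OF _ _ 1 2] assms by auto
qed

lemma complemented_join [simp, intro]:
  assumes "u \<in> complemented" "v \<in> complemented"
  shows "u \<^bold>\<or> v \<in> complemented" "neg (u \<^bold>\<or> v) = neg u \<^bold>\<and> neg v"
proof -
  have "neg (neg u \<^bold>\<and> neg v) = u \<^bold>\<or> v" using assms by simp
  then show "u \<^bold>\<or> v \<in> complemented" "neg (u \<^bold>\<or> v) = neg u \<^bold>\<and> neg v"
    using assms by (metis complemented_meet(1) neg_complemented neg_neg)+
qed

end

text \<open>All operations and both constants are characterised by the order alone, so an order
  isomorphism preserves them. Automorphisms constructed below therefore only need a check of
  bijectivity and order.\<close>

lemma heyting_isoI_order:
  assumes A: "heyting_algebra A" and B: "heyting_algebra B"
    and bij: "bij_betw f (carrier A) (carrier B)"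
    and ord: "\<And>x y. \<lbrakk>x \<in> carrier A; y \<in> carrier A\<rbrakk>
      \<Longrightarrow> heyting_algebra.le A x y \<longleftrightarrow> heyting_algebra.le B (f x) (f y)"
  shows "f \<in> heyting_iso A B"
proof -
  interpret A: heyting_algebra A by fact
  interpret B: heyting_algebra B by fact
  have fc: "f x \<in> carrier B" if "x \<in> carrier A" for x
    using bij that by (auto simp: bij_betw_def)
  have sur: "\<exists>x\<in>carrier A. y = f x" if "y \<in> carrier B" for y
    using bij that by (auto simp: bij_betw_def)
  \<comment> \<open>As \<open>f\<close> is onto, an element of \<open>B\<close> is determined by the
    elements \<open>f z\<close> below it, and likewise by those above it.\<close>
  have eq: "b = c" if "b \<in> carrier B" "c \<in> carrier B" 
    "\<And>z. z \<in> carrier A \<Longrightarrow> B.le (f z) b \<longleftrightarrow> B.le (f z) c" for b c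
    using that sur by (metis B.le_antisym B.le_refl)
  have eq': "b = c" if "b \<in> carrier B" "c \<in> carrier B" 
    "\<And>z. z \<in> carrier A \<Longrightarrow> B.le b (f z) \<longleftrightarrow> B.le c (f z)" for b c
    using that sur by (metis B.le_antisym B.le_refl)
  have meet: "f (x \<^bold>\<and>\<^bsub>A\<^esub> y) = f x \<^bold>\<and>\<^bsub>B\<^esub> f y" if "x \<in> carrier A" "y \<in> carrier A" for x y
    by (rule eq) (use that in \<open>auto simp: fc ord[symmetric]\<close>)
  have join: "f (x \<^bold>\<or>\<^bsub>A\<^esub> y) = f x \<^bold>\<or>\<^bsub>B\<^esub> f y" if "x \<in> carrier A" "y \<in> carrier A" for x y
    by (rule eq') (use that in \<open>auto simp: fc ord[symmetric]\<close>)
  have imp: "f (x \<^bold>\<rightarrow>\<^bsub>A\<^esub> y) = f x \<^bold>\<rightarrow>\<^bsub>B\<^esub> f y" if "x \<in> carrier A" "y \<in> carrier A" for x y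
    by (rule eq) (use that in \<open>auto simp: fc ord[symmetric] A.imp_adjoint B.imp_adjoint meet[symmetric]\<close>)
  have bot: "f \<^bold>0\<^bsub>A\<^esub> = \<^bold>0\<^bsub>B\<^esub>"
    by (rule eq') (auto simp: fc ord[symmetric])
  have top: "f \<^bold>1\<^bsub>A\<^esub> = \<^bold>1\<^bsub>B\<^esub>"
    by (rule eq) (auto simp: fc ord[symmetric])
  show ?thesis
    unfolding heyting_iso_def using bij meet join imp bot top by blast
qed

section \<open>The automorphism group\<close>

context heyting_algebra
begin

abbreviation aut_mult (infixl "\<odot>" 70) where
  "f \<odot> g \<equiv> f \<otimes>\<^bsub>heyting_Aut H\<^esub> g"

lemma meet_disjoint:
  assumes "a \<preceq> p" "b \<preceq> q" "p \<^bold>\<and> q = \<^bold>0"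
    and "a \<in> carrier H" "b \<in> carrier H" "p \<in> carrier H" "q \<in> carrier H"
  shows "a \<^bold>\<and> b = \<^bold>0"
  using meet_mono[OF assms(1,2)] assms(3-) by simp

lemma auto_iff: "f \<in> heyting_auto H \<longleftrightarrow> f \<in> extensional (carrier H) \<and> f \<in> heyting_iso H H"
  unfolding heyting_auto_def Bij_def heyting_iso_def by blast

lemma auto_Bij: "f \<in> heyting_auto H \<Longrightarrow> f \<in> Bij (carrier H)"
  by (simp add: heyting_auto_def)

lemma auto_bij: "f \<in> heyting_auto H \<Longrightarrow> bij_betw f (carrier H) (carrier H)"
  by (simp add: heyting_auto_def Bij_def)

lemma auto_inj: "f \<in> heyting_auto H \<Longrightarrow> inj_on f (carrier H)"
  by (rule bij_betw_imp_inj_on[OF auto_bij])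

lemma auto_le_iff:
  assumes "f \<in> heyting_auto H" "x \<in> carrier H" "y \<in> carrier H"
  shows "f x \<preceq> f y \<longleftrightarrow> x \<preceq> y"
proof -
  have "f (x \<^bold>\<and> y) = f x \<^bold>\<and> f y"
    using assms unfolding auto_iff heyting_iso_def by blast
  then show ?thesis
    using assms inj_on_eq_iff[OF auto_inj[OF assms(1)], of "x \<^bold>\<and> y" x] by (simp add: le_def)
qed

lemma restrict_auto:
  assumes "bij_betw f (carrier H) (carrier H)"
    and "\<And>x y. \<lbrakk>x \<in> carrier H; y \<in> carrier H\<rbrakk> \<Longrightarrow> f x \<preceq> f y \<longleftrightarrow> x \<preceq> y"
  shows "restrict f (carrier H) \<in> heyting_auto H"
proof -
  have "restrict f (carrier H) \<in> heyting_iso H H"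
    by (rule heyting_isoI_order) (use assms heyting_algebra_axioms in \<open>auto cong: bij_betw_cong\<close>)
  then show ?thesis by (simp add: auto_iff)
qed

lemma subgroup_heyting_auto: "subgroup (heyting_auto H) (BijGroup (carrier H))"
proof (rule subgroup.intro)
  show "heyting_auto H \<subseteq> carrier (BijGroup (carrier H))"
    by (auto simp: auto_Bij BijGroup_def)
next
  fix f g assume fg: "f \<in> heyting_auto H" "g \<in> heyting_auto H"
  have g: "g x \<in> carrier H" if "x \<in> carrier H" for x
    using auto_bij[OF fg(2)] that by (auto simp: bij_betw_def)
  have "compose (carrier H) f g \<in> heyting_auto H"
    unfolding compose_def using fg g auto_bij[THEN bij_betw_trans, of g f]
    by (intro restrict_auto) (simp_all add: auto_le_iff auto_bij comp_def)
  then show "f \<otimes>\<^bsub>BijGroup (carrier H)\<^esub> g \<in> heyting_auto H"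
    using fg by (simp add: BijGroup_def auto_Bij)
next
  show "\<one>\<^bsub>BijGroup (carrier H)\<^esub> \<in> heyting_auto H"
    unfolding BijGroup_def using restrict_auto[of "\<lambda>x. x"] by (simp add: bij_betw_def)
next
  fix f assume f: "f \<in> heyting_auto H"
  let ?k = "inv_into (carrier H) f"
  have k: "?k x \<in> carrier H" "f (?k x) = x" if "x \<in> carrier H" for x
    using auto_bij[OF f] that
    by (auto simp: bij_betw_def inv_into_into f_inv_into_f)
  have "restrict ?k (carrier H) \<in> heyting_auto H"
  proof (rule restrict_auto)
    show "?k x \<preceq> ?k y \<longleftrightarrow> x \<preceq> y" if "x \<in> carrier H" "y \<in> carrier H" for x y
      using that auto_le_iff[OF f, of "?k x" "?k y"] by (simp add: k)
  qed (simp add: auto_bij bij_betw_inv_into f)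
  then show "inv\<^bsub>BijGroup (carrier H)\<^esub> f \<in> heyting_auto H"
    by (simp add: inv_BijGroup auto_Bij f)
qed

lemma group_heyting_Aut: "group (heyting_Aut H)"
  unfolding heyting_Aut_def
  by (rule subgroup.subgroup_is_group[OF subgroup_heyting_auto group_BijGroup])

end

sublocale heyting_algebra \<subseteq> Aut: group "heyting_Aut H"
  by (rule group_heyting_Aut)

section \<open>Evaluation and supports of automorphisms\<close>

context heyting_algebra
begin

lemma carrier_Aut: "carrier (heyting_Aut H) = heyting_auto H"
  by (simp add: heyting_Aut_def)

lemma aut_closed [simp]: "\<lbrakk>f \<in> carrier (heyting_Aut H); x \<in> carrier H\<rbrakk> \<Longrightarrow> f x \<in> carrier H"
  using auto_bij unfolding carrier_Aut by (auto simp: bij_betw_def)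

lemma aut_mult [simp]:
  "\<lbrakk>f \<in> carrier (heyting_Aut H); g \<in> carrier (heyting_Aut H); x \<in> carrier H\<rbrakk> \<Longrightarrow> (f \<odot> g) x = f (g x)"
  unfolding carrier_Aut by (simp add: heyting_Aut_def BijGroup_def auto_Bij compose_def)

lemma aut_one [simp]: "x \<in> carrier H \<Longrightarrow> \<one>\<^bsub>heyting_Aut H\<^esub> x = x"
  by (simp add: heyting_Aut_def BijGroup_def)

lemma aut_inv [simp]:
  assumes "f \<in> carrier (heyting_Aut H)" "x \<in> carrier H"
  shows "(inv\<^bsub>heyting_Aut H\<^esub> f) (f x) = x" "f ((inv\<^bsub>heyting_Aut H\<^esub> f) x) = x"
  using assms aut_mult[of "inv\<^bsub>heyting_Aut H\<^esub> f" f x] aut_mult[of f "inv\<^bsub>heyting_Aut H\<^esub> f" x] by simp_all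

lemma aut_eqI:
  assumes "f \<in> carrier (heyting_Aut H)" "g \<in> carrier (heyting_Aut H)"
    and "\<And>x. x \<in> carrier H \<Longrightarrow> f x = g x"
  shows "f = g"
  using assms unfolding carrier_Aut auto_iff by (auto intro: extensionalityI)

lemma aut_le_iff [simp]:
  "\<lbrakk>f \<in> carrier (heyting_Aut H); x \<in> carrier H; y \<in> carrier H\<rbrakk> \<Longrightarrow> f x \<preceq> f y \<longleftrightarrow> x \<preceq> y"
  by (simp add: carrier_Aut auto_le_iff)

lemma aut_eq_iff [simp]:
  "\<lbrakk>f \<in> carrier (heyting_Aut H); x \<in> carrier H; y \<in> carrier H\<rbrakk> \<Longrightarrow> f x = f y \<longleftrightarrow> x = y"
  by (metis aut_inv(1))

lemma aut_hom:
  assumes "f \<in> carrier (heyting_Aut H)" "x \<in> carrier H" "y \<in> carrier H"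
  shows "f (x \<^bold>\<and> y) = f x \<^bold>\<and> f y" "f (x \<^bold>\<or> y) = f x \<^bold>\<or> f y" "f (x \<^bold>\<rightarrow> y) = f x \<^bold>\<rightarrow> f y"
  using assms unfolding carrier_Aut auto_iff heyting_iso_def by blast+

lemma aut_bounds [simp]:
  assumes "f \<in> carrier (heyting_Aut H)"
  shows "f \<^bold>0 = \<^bold>0" "f \<^bold>1 = \<^bold>1"
  using assms unfolding carrier_Aut auto_iff heyting_iso_def by blast+

lemma aut_neg: "\<lbrakk>f \<in> carrier (heyting_Aut H); x \<in> carrier H\<rbrakk> \<Longrightarrow> f (neg x) = neg (f x)"
  by (simp add: neg_def aut_hom)

lemma aut_complemented [simp]: 
  assumes "f \<in> carrier (heyting_Aut H)" "u \<in> complemented"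
  shows "f u \<in> complemented"
  using complement_unique(1)[of "f u" "f (neg u)"] assms by (simp flip: aut_hom)

lemma aut_orderI:
  assumes "bij_betw f (carrier H) (carrier H)"
    and "\<And>x y. \<lbrakk>x \<in> carrier H; y \<in> carrier H\<rbrakk> \<Longrightarrow> f x \<preceq> f y \<longleftrightarrow> x \<preceq> y"
  shows "restrict f (carrier H) \<in> carrier (heyting_Aut H)"
  using restrict_auto[OF assms] by (simp add: carrier_Aut)

text \<open>For complemented \<open>u\<close>, the condition \<open>fixes_below f (neg u)\<close>
  encodes that \<open>f\<close> is supported on \<open>u\<close>, without any reference to points of
  a dual space.\<close>

definition fixes_below :: "('a \<Rightarrow> 'a) \<Rightarrow> 'a \<Rightarrow> bool" where
  "fixes_below f u \<longleftrightarrow> (\<forall>x\<in>carrier H. x \<preceq> u \<longrightarrow> f x = x)"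

lemma fixes_belowD: "\<lbrakk>fixes_below f u; x \<preceq> u; x \<in> carrier H\<rbrakk> \<Longrightarrow> f x = x"
  by (simp add: fixes_below_def)

lemma fixes_below_mono:
  "\<lbrakk>fixes_below f u; v \<preceq> u; u \<in> carrier H; v \<in> carrier H\<rbrakk> \<Longrightarrow> fixes_below f v"
  unfolding fixes_below_def using le_trans by blast

lemma fixes_below_support:
  assumes "f \<in> carrier (heyting_Aut H)" "u \<in> complemented" "fixes_below f (neg u)"
  shows "f u = u"
proof -
  have "f (neg u) = neg u" using assms by (simp add: fixes_below_def)
  then show ?thesis using assms aut_neg[of f "neg u"] by simp
qed

lemma fixes_below_neg:
  assumes "f \<in> carrier (heyting_Aut H)" "u \<in> complemented" "fixes_below f u"
  shows "f (neg u) = neg u"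
  using fixes_below_support[of f "neg u"] assms by simp

text \<open>Such an \<open>x\<close> is the join of \<open>u\<close>, which is fixed as the
  complement of a fixed element, and of a part outside \<open>u\<close>, which is fixed by
  hypothesis.\<close>

lemma fixes_above_support:
  assumes "f \<in> carrier (heyting_Aut H)" "u \<in> complemented" "fixes_below f (neg u)" "x \<in> carrier H" "u \<preceq> x"
  shows "f x = x"
proof -
  have "x \<^bold>\<and> u = u" using assms le_antisym[of "x \<^bold>\<and> u" u] by simp
  then have x: "x = u \<^bold>\<or> (x \<^bold>\<and> neg u)" using complemented_decomp[of u x] assms by simp
  have "f x = f u \<^bold>\<or> f (x \<^bold>\<and> neg u)"
    using assms by (subst x) (simp add: aut_hom)
  also have "\<dots> = x"
    using assms x fixes_below_support[OF assms(1-3)] by (simp add: fixes_below_def)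
  finally show ?thesis .
qed

text \<open>Each \<open>x\<close> splits into its parts inside and outside \<open>c\<close>. Both
  maps preserve \<open>c\<close> and \<open>neg c\<close>, and on each part one of the two is the
  identity.\<close>

lemma disjoint_support_commute:
  assumes s: "s \<in> carrier (heyting_Aut H)" "fixes_below s (neg c)"
    and m: "m \<in> carrier (heyting_Aut H)" "fixes_below m c"
    and c: "c \<in> complemented"
  shows "m \<odot> s = s \<odot> m"
proof (rule aut_eqI)
  fix x assume x: "x \<in> carrier H"
  let ?a = "x \<^bold>\<and> c" and ?b = "x \<^bold>\<and> neg c"
  have ab: "?a \<in> carrier H" "?b \<in> carrier H" using x c by auto
  have 1: "m ?a = ?a" using m x c by (simp add: fixes_below_def)
  have 2: "s ?b = ?b" using s x c by (simp add: fixes_below_def)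
  have "s ?a \<preceq> s c" using s x c by simp
  then have "s ?a \<preceq> c" using fixes_below_support[OF s(1) c s(2)] by simp
  then have 3: "m (s ?a) = s ?a" using m s x c by (simp add: fixes_below_def)
  have "m ?b \<preceq> m (neg c)" using m x c by simp
  then have "m ?b \<preceq> neg c" using fixes_below_neg[OF m(1) c m(2)] by simp
  then have 4: "s (m ?b) = m ?b" using m s x c by (simp add: fixes_below_def)
  have "m (s (?a \<^bold>\<or> ?b)) = s (m (?a \<^bold>\<or> ?b))"
    using ab s(1) m(1) by (simp add: aut_hom(2) 1 2 3 4)
  then show "(m \<odot> s) x = (s \<odot> m) x"
    using s m x complemented_decomp[OF c x] by simp
qed (use s m in auto)

text \<open>Localises \<open>h\<close>: when \<open>h\<close> moves \<open>u\<close> off itself, its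
  action on \<open>u\<close> is already realised by an automorphism supported on \<open>u\<close>
  and its image. That automorphism exchanges the two pieces by \<open>h\<close> and its
  inverse.\<close>

lemma swap:
  assumes h: "h \<in> carrier (heyting_Aut H)" and u: "u \<in> complemented" and disj: "u \<^bold>\<and> h u = \<^bold>0"
  obtains t where "t \<in> carrier (heyting_Aut H)"
    and "\<And>x. \<lbrakk>x \<in> carrier H; x \<preceq> u\<rbrakk> \<Longrightarrow> t x = h x"
    and "fixes_below t (neg (u \<^bold>\<or> h u))"
proof -
  define v where "v = h u"
  define w where "w = neg (u \<^bold>\<or> v)"
  define k where "k = inv\<^bsub>heyting_Aut H\<^esub> h"
  have k: "k \<in> carrier (heyting_Aut H)" using h by (simp add: k_def)
  have hk: "h (k x) = x" "k (h x) = x" if "x \<in> carrier H" for x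
    using h that by (simp_all add: k_def)
  have v: "v \<in> complemented" using h u by (simp add: v_def)
  have w: "w \<in> complemented" using u v by (simp add: w_def)
  have uvw: "u \<in> carrier H" "v \<in> carrier H" "w \<in> carrier H" using u v w by auto
  have uv: "u \<^bold>\<and> v = \<^bold>0" using disj by (simp add: v_def)
  have uw: "u \<^bold>\<and> w = \<^bold>0"
    using le_neg_iff[of u w] u v by (simp add: w_def)
  have vw: "v \<^bold>\<and> w = \<^bold>0"
    using le_neg_iff[of v w] u v by (simp add: w_def)
  note comm = meet_comm[OF uvw(1,2)] meet_comm[OF uvw(1,3)] meet_comm[OF uvw(2,3)]
  have kv: "k v = u" using hk uvw by (simp add: v_def)
  define p where "p x = h (x \<^bold>\<and> u)" for x
  define q where "q x = k (x \<^bold>\<and> v)" for x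
  \<comment> \<open>\<open>p\<close> carries the part of \<open>x\<close> in \<open>u\<close> over
    to \<open>v\<close>, \<open>q\<close> carries the part in \<open>v\<close> back to
    \<open>u\<close>, and the part in the remainder \<open>w\<close> stays.\<close>
  define t where "t x = (p x \<^bold>\<or> q x) \<^bold>\<or> (x \<^bold>\<and> w)" for x
  have p: "p x \<in> carrier H" "p x \<preceq> v" if "x \<in> carrier H" for x
    using that h u unfolding p_def v_def by simp_all
  have q: "q x \<in> carrier H" "q x \<preceq> u" if "x \<in> carrier H" for x
  proof -
    show "q x \<in> carrier H" using that k v by (simp add: q_def)
    have "k (x \<^bold>\<and> v) \<preceq> k v" using that k v by simp
    then show "q x \<preceq> u" by (simp add: q_def kv)
  qed
  have tc: "t x \<in> carrier H" if "x \<in> carrier H" for x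
    using that p q uvw by (simp add: t_def)
  \<comment> \<open>Cutting \<open>t x\<close> by \<open>u\<close>, \<open>v\<close> and
    \<open>w\<close> recovers its three pieces, so applying \<open>t\<close> again restores
    \<open>x\<close>.\<close>
  have tu: "t x \<^bold>\<and> u = q x" if x: "x \<in> carrier H" for x
  proof -
    have "p x \<^bold>\<and> u = \<^bold>0" "(x \<^bold>\<and> w) \<^bold>\<and> u = \<^bold>0"
      using p[OF x] x uvw uv uw comm by (simp_all add: meet_disjoint[of _ v _ u] meet_disjoint[of _ w _ u])
    then show ?thesis using p[OF x] q[OF x] x uvw by (simp add: t_def distrib2 meet_eq_left)
  qed
  have tv: "t x \<^bold>\<and> v = p x" if x: "x \<in> carrier H" for x
  proof -
    have "q x \<^bold>\<and> v = \<^bold>0" "(x \<^bold>\<and> w) \<^bold>\<and> v = \<^bold>0"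
      using q[OF x] x uvw uv vw comm by (simp_all add: meet_disjoint[of _ u _ v] meet_disjoint[of _ w _ v])
    then show ?thesis using p[OF x] q[OF x] x uvw by (simp add: t_def distrib2 meet_eq_left)
  qed
  have tw: "t x \<^bold>\<and> w = x \<^bold>\<and> w" if x: "x \<in> carrier H" for x
  proof -
    have "q x \<^bold>\<and> w = \<^bold>0" "p x \<^bold>\<and> w = \<^bold>0"
      using p[OF x] q[OF x] x uvw uw vw by (simp_all add: meet_disjoint[of _ u _ w] meet_disjoint[of _ v _ w])
    then show ?thesis using p[OF x] q[OF x] x uvw by (simp add: t_def distrib2 meet_eq_left)
  qed
  have split: "x = ((x \<^bold>\<and> u) \<^bold>\<or> (x \<^bold>\<and> v)) \<^bold>\<or> (x \<^bold>\<and> w)" if "x \<in> carrier H" for x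
    using complemented_decomp[of "u \<^bold>\<or> v" x] that u v by (simp add: w_def distrib)
  have tt: "t (t x) = x" if x: "x \<in> carrier H" for x
  proof -
    have "t (t x) = (h (q x) \<^bold>\<or> k (p x)) \<^bold>\<or> (x \<^bold>\<and> w)"
      using tu[OF x] tv[OF x] tw[OF x] by (simp add: t_def[of "t x"] p_def[of "t x"] q_def[of "t x"])
    also have "\<dots> = ((x \<^bold>\<and> v) \<^bold>\<or> (x \<^bold>\<and> u)) \<^bold>\<or> (x \<^bold>\<and> w)"
      using x uvw by (simp add: q_def p_def hk)
    also have "\<dots> = x" using split[OF x] x uvw join_comm[of "x \<^bold>\<and> u" "x \<^bold>\<and> v"] by simp
    finally show ?thesis .
  qed
  have mono: "t x \<preceq> t y" if "x \<preceq> y" "x \<in> carrier H" "y \<in> carrier H" for x y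
  proof -
    have "p x \<preceq> p y" "q x \<preceq> q y" "x \<^bold>\<and> w \<preceq> y \<^bold>\<and> w"
      using that h k uvw meet_mono[of x y u u] meet_mono[of x y v v] meet_mono[of x y w w]
      by (simp_all add: p_def q_def)
    then show ?thesis
      unfolding t_def using that p q uvw by (intro join_mono) auto
  qed
  \<comment> \<open>A monotone involution is bijective and also reflects the order.\<close>
  have "restrict t (carrier H) \<in> carrier (heyting_Aut H)"
  proof (rule aut_orderI)
    show "bij_betw t (carrier H) (carrier H)"
      by (rule bij_betw_byWitness[where f' = t]) (use tt tc in auto)
    show "t x \<preceq> t y \<longleftrightarrow> x \<preceq> y" if "x \<in> carrier H" "y \<in> carrier H" for x y
      using that mono[of x y] mono[of "t x" "t y"] by (auto simp: tt tc)
  qed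
  moreover have "restrict t (carrier H) x = h x" if x: "x \<in> carrier H" "x \<preceq> u" for x
  proof -
    have "x \<^bold>\<and> u = x" "x \<^bold>\<and> v = \<^bold>0" "x \<^bold>\<and> w = \<^bold>0"
      using x uvw uv uw by (simp_all add: meet_eq_left meet_disjoint[of _ u _ v] meet_disjoint[of _ u _ w])
    then show ?thesis using x h k by (simp add: t_def p_def q_def)
  qed
  moreover have "restrict t (carrier H) x = x" if x: "x \<in> carrier H" "x \<preceq> w" for x
  proof -
    have "x \<^bold>\<and> w = x" "x \<^bold>\<and> v = \<^bold>0" "x \<^bold>\<and> u = \<^bold>0"
      using x uvw uw vw comm by (simp_all add: meet_eq_left meet_disjoint[of _ w _ v] meet_disjoint[of _ w _ u])
    then show ?thesis using x h k by (simp add: t_def p_def q_def)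
  qed
  ultimately show ?thesis
    using that[of "restrict t (carrier H)"] by (simp add: fixes_below_def v_def w_def)
qed

end

section \<open>Infinite products of automorphisms with disjoint supports\<close>

context heyting_algebra
begin

definition converging :: "(nat \<Rightarrow> 'a) \<Rightarrow> bool" where
  "converging d \<longleftrightarrow> (\<forall>n. d n \<in> complemented \<and> d (Suc n) \<preceq> d n)
     \<and> (\<forall>a\<in>carrier H. \<exists>n. d n \<preceq> a \<or> d n \<^bold>\<and> a = \<^bold>0)"

lemma converging_complemented [simp]: "converging d \<Longrightarrow> d n \<in> complemented"
  by (simp add: converging_def)

lemma converging_antimono:
  assumes "converging d" "m \<le> n"
  shows "d n \<preceq> d m"
  using assms(2)
proof (induction n rule: dec_induct)
  case (step k)
  then show ?case
    using assms(1) le_trans[of "d (Suc k)" "d k" "d m"] by (auto simp: converging_def)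
qed (use assms(1) in simp)

lemma converging_subseq:
  assumes "converging d" "\<And>n. r n \<le> r (Suc n)" "\<And>n. n \<le> r n"
  shows "converging (\<lambda>n. d (r n))"
proof -
  have "\<exists>n. d (r n) \<preceq> a \<or> d (r n) \<^bold>\<and> a = \<^bold>0" if a: "a \<in> carrier H" for a
  proof -
    obtain n where n: "d n \<preceq> a \<or> d n \<^bold>\<and> a = \<^bold>0"
      using assms(1) a by (auto simp: converging_def)
    have le: "d (r n) \<preceq> d n" using converging_antimono assms by blast
    have "d (r n) \<preceq> a" if "d n \<preceq> a"
      using le_trans[OF le that] a assms(1) by simp
    moreover have "d (r n) \<^bold>\<and> a = \<^bold>0" if "d n \<^bold>\<and> a = \<^bold>0"
      using meet_disjoint[OF le le_refl that] a assms(1) by simp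
    ultimately show ?thesis using n by blast
  qed
  then show ?thesis
    using converging_antimono[OF assms(1,2)] assms(1) unfolding converging_def by blast
qed

text \<open>The new factor stands on the right and is thus applied first, so the value at
  \<open>x\<close> does not change from stage \<open>m\<close> to the next once \<open>f m\<close>
  fixes \<open>x\<close>.\<close>

primrec aut_prod :: "(nat \<Rightarrow> 'a \<Rightarrow> 'a) \<Rightarrow> nat \<Rightarrow> 'a \<Rightarrow> 'a" where
  "aut_prod f 0 = \<one>\<^bsub>heyting_Aut H\<^esub>"
| "aut_prod f (Suc m) = aut_prod f m \<odot> f m"

context
  fixes d f
  assumes d: "converging d"
    and f: "\<And>n. f n \<in> carrier (heyting_Aut H)"
    and off: "\<And>n. fixes_below (f n) (neg (d n))" "\<And>n. fixes_below (f n) (d (Suc n))"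
begin

lemma aut_prod_closed [simp]: "aut_prod f m \<in> carrier (heyting_Aut H)"
  by (induction m) (simp_all add: f)

text \<open>Every factor occurring has an index \<open>k < n\<close> and fixes all elements below
  \<open>d (Suc k)\<close>, hence all below \<open>d n\<close>.\<close>

lemma aut_prod_later:
  assumes "x \<in> carrier H" "x \<preceq> d n" "m \<le> n"
  shows "aut_prod f m x = x"
  using assms(3)
proof (induction m)
  case (Suc m)
  have "x \<preceq> d (Suc m)"
    using le_trans[OF assms(2) converging_antimono[OF d Suc.prems]] d assms(1) by simp
  then have "f m x = x" using off(2) assms(1) by (simp add: fixes_below_def)
  then show ?case using Suc assms(1) by (simp add: f)
qed (use assms(1) in simp)

text \<open>The factors from index \<open>n\<close> on are supported below \<open>d n\<close>, and
  an element that contains or misses \<open>d n\<close> contains or misses those supports.\<close>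

lemma aut_prod_stable:
  assumes x: "x \<in> carrier H" "d n \<preceq> x \<or> d n \<^bold>\<and> x = \<^bold>0" and "n \<le> m"
  shows "aut_prod f m x = aut_prod f n x"
  using assms(3)
proof (induction m rule: dec_induct)
  case (step m)
  have le: "d m \<preceq> d n" using converging_antimono[OF d] step by simp
  have "f m x = x"
  proof (cases "d n \<preceq> x")
    case True
    then show ?thesis
      using fixes_above_support[OF f _ off(1) x(1)] le_trans[OF le] d x(1) by simp
  next
    case False
    then have "x \<preceq> neg (d m)"
      using x d meet_disjoint[OF le le_refl, of x] meet_comm[of x "d m"] by (simp add: le_neg_iff)
    then show ?thesis using off(1) x(1) by (simp add: fixes_below_def)
  qed
  then show ?case using step x(1) by (simp add: f)
qed simp

text \<open>As \<open>x\<close> misses \<open>d (Suc n)\<close>, the product is stable from stage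
  \<open>Suc n\<close> on. Its last factor \<open>f n\<close> keeps \<open>x\<close> below
  \<open>d n\<close>, where the earlier factors are the identity.\<close>

lemma aut_prod_block:
  assumes x: "x \<in> carrier H" "x \<preceq> d n" "x \<preceq> neg (d (Suc n))" and "n < m"
  shows "aut_prod f m x = f n x"
proof -
  have "f n x \<preceq> f n (d n)" using x d f by simp
  also have "f n (d n) = d n" using fixes_below_support[OF f _ off(1)] d by simp
  finally have 1: "aut_prod f n (f n x) = f n x"
    using aut_prod_later[of "f n x" n n] x f by simp
  have "d (Suc n) \<^bold>\<and> x = \<^bold>0"
    using x d meet_comm[of x "d (Suc n)"] by (simp add: le_neg_iff)
  then have "aut_prod f m x = aut_prod f (Suc n) x"
    using aut_prod_stable[of x "Suc n" m] assms by simp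
  then show ?thesis using 1 x f by simp
qed

lemma aut_prod_off:
  assumes x: "x \<in> carrier H" "x \<preceq> neg (d 0)"
  shows "aut_prod f m x = x"
  using aut_prod_stable[of x 0 m] x d meet_comm[of x "d 0"] by (simp add: le_neg_iff)

text \<open>At each element the finite products are eventually constant, and \<open>F\<close> is the
  eventual value. Finitely many elements can be treated at a common stage, where \<open>F\<close>
  agrees with an automorphism.\<close>

lemma infinite_product:
  obtains F where "F \<in> carrier (heyting_Aut H)"
    and "\<And>x. x \<in> carrier H \<Longrightarrow> \<exists>N. \<forall>m\<ge>N. F x = aut_prod f m x"
proof -
  \<comment> \<open>\<open>st n x\<close> says that \<open>d n\<close> decides \<open>x\<close>;
    from such a stage on the finite products agree at \<open>x\<close>.\<close>
  define st where "st n x \<longleftrightarrow> d n \<preceq> x \<or> d n \<^bold>\<and> x = \<^bold>0" for n x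
  define N where "N x = (SOME n. st n x)" for x
  define F where "F x = aut_prod f (N x) x" for x
  have stN: "st (N x) x" if "x \<in> carrier H" for x
  proof -
    have "\<exists>n. st n x" using d that by (simp add: converging_def st_def)
    then show ?thesis unfolding N_def by (rule someI_ex)
  qed
  have F: "F x = aut_prod f m x" if "x \<in> carrier H" "m \<ge> N x" for x m
    using aut_prod_stable[of x "N x" m] stN that by (simp add: F_def st_def)
  have F': "F x = aut_prod f n x" if "x \<in> carrier H" "st n x" for x n
    using aut_prod_stable[of x n "max n (N x)"] F[of x "max n (N x)"] that by (simp add: st_def)
  have ord: "F x \<preceq> F y \<longleftrightarrow> x \<preceq> y" if "x \<in> carrier H" "y \<in> carrier H" for x y
    using F[of x "max (N x) (N y)"] F[of y "max (N x) (N y)"] that by simp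
  have Fc: "F x \<in> carrier H" if "x \<in> carrier H" for x
    using that by (simp add: F_def)
  have inj: "inj_on F (carrier H)"
  proof (rule inj_onI)
    fix x y assume xy: "x \<in> carrier H" "y \<in> carrier H" "F x = F y"
    then have "F x \<preceq> F y" "F y \<preceq> F x" using Fc by simp_all
    then show "x = y" using xy ord le_antisym by blast
  qed
  have surj: "y \<in> F ` carrier H" if y: "y \<in> carrier H" for y
  proof -
    \<comment> \<open>The finite product at the stage of \<open>y\<close> fixes
      \<open>d (N y)\<close>. The preimage of \<open>y\<close> under it is therefore decided at the
      same stage, and \<open>F\<close> takes the value \<open>y\<close> there.\<close>
    let ?g = "aut_prod f (N y)"
    define x where "x = (inv\<^bsub>heyting_Aut H\<^esub> ?g) y"
    have x: "x \<in> carrier H" "?g x = y" using y by (simp_all add: x_def)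
    have fx: "?g (d (N y)) = d (N y)" using aut_prod_later[of "d (N y)" "N y" "N y"] d by simp
    have "st (N y) x"
      using stN[OF y] unfolding st_def
    proof
      assume "d (N y) \<preceq> y"
      then have "?g (d (N y)) \<preceq> ?g x" by (simp only: fx x)
      then have "d (N y) \<preceq> x"
        by (subst (asm) aut_le_iff[OF aut_prod_closed]) (use x(1) d in simp_all)
      then show "d (N y) \<preceq> x \<or> d (N y) \<^bold>\<and> x = \<^bold>0" ..
    next
      assume "d (N y) \<^bold>\<and> y = \<^bold>0"
      then have "?g (d (N y) \<^bold>\<and> x) = ?g \<^bold>0" using x d by (simp add: aut_hom fx del: aut_eq_iff)
      then show "d (N y) \<preceq> x \<or> d (N y) \<^bold>\<and> x = \<^bold>0" using x d by (simp del: aut_bounds)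
    qed
    then show ?thesis using F' x by force
  qed
  have "restrict F (carrier H) \<in> carrier (heyting_Aut H)"
    by (rule aut_orderI) (use inj surj Fc ord in \<open>auto simp: bij_betw_def\<close>)
  moreover have "\<exists>N. \<forall>m\<ge>N. restrict F (carrier H) x = aut_prod f m x" if "x \<in> carrier H" for x
    using F that by auto
  ultimately show ?thesis by (rule that)
qed

end

end

text \<open>Collects the properties of the Fraisse limit from which the group theory follows. The
  clause \<open>c \<noteq> a\<close> in \<open>dense\<close> lets sequences descend strictly, so
  that their layers are nonzero.\<close>

locale homogeneous_heyting = heyting_algebra +
  assumes nontrivial: "\<^bold>0 \<noteq> \<^bold>1"
    and countable_carrier: "countable (carrier H)"
    and homogeneous: "\<lbrakk>u \<in> complemented; v \<in> complemented; u \<noteq> \<^bold>0; u \<noteq> \<^bold>1; v \<noteq> \<^bold>0; v \<noteq> \<^bold>1\<rbrakk>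
      \<Longrightarrow> \<exists>h\<in>carrier (heyting_Aut H). h u = v"
    and dense: "\<lbrakk>a \<in> carrier H; b \<in> carrier H; \<not> a \<preceq> b\<rbrakk> \<Longrightarrow> \<exists>c\<in>complemented. c \<preceq> a \<and> \<not> c \<preceq> b \<and> c \<noteq> a"
begin

lemma shrink:
  assumes "a \<in> carrier H" "a \<noteq> \<^bold>0"
  obtains c where "c \<in> complemented" "c \<preceq> a" "c \<noteq> \<^bold>0" "c \<noteq> a"
  using dense[of a "\<^bold>0"] assms by auto

text \<open>Enumerate the carrier and, at step \<open>n\<close>, pass to a strictly smaller nonzero
  complemented element that decides the \<open>n\<close>-th element.\<close>

lemma strict_converging:
  assumes c: "c \<in> complemented" "c \<noteq> \<^bold>0"
  obtains d where "converging d" "d 0 = c" "\<And>n. d (Suc n) \<noteq> d n"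
proof -
  obtain e :: "nat \<Rightarrow> 'a" where e: "range e = carrier H"
    using countable_carrier bot_closed by (metis empty_iff uncountable_def)
  let ?P = "\<lambda>u. u \<in> complemented \<and> u \<noteq> \<^bold>0"
  let ?Q = "\<lambda>n u v. v \<preceq> u \<and> v \<noteq> u \<and> (v \<preceq> e n \<or> v \<^bold>\<and> e n = \<^bold>0)"
  have "\<exists>v. ?P v \<and> ?Q n u v" if u: "?P u" for n u
  proof (cases "u \<^bold>\<and> e n = \<^bold>0")
    case True
    obtain v where v: "v \<in> complemented" "v \<preceq> u" "v \<noteq> \<^bold>0" "v \<noteq> u" using shrink[of u] u by auto
    moreover have "v \<^bold>\<and> e n = \<^bold>0" using meet_disjoint[of v u "e n" "e n"] v u True e by auto
    ultimately show ?thesis by blast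
  next
    case False
    have en: "e n \<in> carrier H" using e by auto
    obtain v where v: "v \<in> complemented" "v \<preceq> u \<^bold>\<and> e n" "v \<noteq> \<^bold>0" "v \<noteq> u \<^bold>\<and> e n"
      using shrink[of "u \<^bold>\<and> e n"] u False en by auto
    then have le: "v \<preceq> u" "v \<preceq> e n" using u en by auto
    have "v \<noteq> u" using v le en le_def by metis
    then show ?thesis using v le by blast
  qed
  \<comment> \<open>The clause for \<open>n = 0\<close> in the predicate pins the start of the
    dependent choice to \<open>c\<close>.\<close>
  then obtain d where d0: "d 0 = c" and d: "\<And>n. ?P (d n)" "\<And>n. ?Q n (d n) (d (Suc n))"
    using dependent_nat_choice[of "\<lambda>n u. (n = 0 \<longrightarrow> u = c) \<and> ?P u" ?Q] c by (smt (verit) nat.distinct(1))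
  have "converging d"
    unfolding converging_def using d e by (metis (no_types, lifting) rangeE)
  then show ?thesis using that d0 d by blast
qed


section \<open>The layers of a converging sequence and the shift along them\<close>

context
  fixes d c
  assumes d: "converging d" and strict: "\<And>n. d (Suc n) \<noteq> d n"
  defines c_def: "c \<equiv> \<lambda>n. d n \<^bold>\<and> neg (d (Suc n))"
begin

lemma layer_complemented [simp]: "c n \<in> complemented"
  using d by (simp add: c_def)

lemma layer_le: "m \<le> n \<Longrightarrow> c n \<preceq> d m"
  using converging_antimono[OF d, of m n] d le_trans[OF meet_le1, of "d n" "neg (d (Suc n))" "d m"]
  by (simp add: c_def)

lemma layer_le_neg: "n < m \<Longrightarrow> c n \<preceq> neg (d m)"
  using converging_antimono[OF d, of "Suc n" m] d neg_antimono[of "d m" "d (Suc n)"]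
    le_trans[OF meet_le2, of "d n" "neg (d (Suc n))" "neg (d m)"]
  by (simp add: c_def)

lemma layer_nonzero: "c n \<noteq> \<^bold>0"
proof
  assume "c n = \<^bold>0"
  then have "d n \<preceq> d (Suc n)" using meet_neg_top[of "d (Suc n)" "d n"] d by (simp add: c_def)
  then have "d n = d (Suc n)" using d converging_antimono[OF d, of n "Suc n"] by (intro le_antisym) auto
  then show False using strict by metis
qed

lemma layer_disjoint:
  assumes "n < m"
  shows "c n \<^bold>\<and> c m = \<^bold>0"
  by (rule meet_disjoint[OF layer_le_neg[OF assms] layer_le[OF order_refl]]) (use d in auto)

lemma layer_not_top: "c n \<noteq> \<^bold>1"
  using layer_disjoint[of n "Suc n"] layer_nonzero[of "Suc n"] by auto

text \<open>Homogeneity and \<open>swap\<close> give an automorphism carrying each layer to the next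
  within these two layers. Taken for the disjoint pairs of layers \<open>2 * n\<close> and
  \<open>2 * n + 1\<close>, they can all be multiplied together.\<close>

lemma even_swap:
  obtains s where "s \<in> carrier (heyting_Aut H)" "fixes_below s (neg (d 0))"
    and "\<And>n. s (c (2 * n)) = c (2 * n + 1)"
proof -
  have "\<exists>t. t \<in> carrier (heyting_Aut H) \<and> t (c n) = c (Suc n)
      \<and> fixes_below t (neg (d n)) \<and> fixes_below t (d (Suc (Suc n)))" for n
  proof -
    obtain h where h: "h \<in> carrier (heyting_Aut H)" "h (c n) = c (Suc n)"
      using homogeneous[of "c n" "c (Suc n)"] layer_nonzero layer_not_top by auto
    have "c n \<^bold>\<and> h (c n) = \<^bold>0" using h layer_disjoint[of n "Suc n"] by simp
    from swap[OF h(1) layer_complemented this] obtain t where t: "t \<in> carrier (heyting_Aut H)"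
      "t (c n) = c (Suc n)" "fixes_below t (neg (c n \<^bold>\<or> c (Suc n)))"
      using h(2) by (metis complemented_closed le_refl layer_complemented)
    have "neg (d n) \<preceq> neg (c n \<^bold>\<or> c (Suc n))"
      using layer_le[of n n] layer_le[of n "Suc n"] d by (intro neg_antimono) auto
    moreover have "d (Suc (Suc n)) \<preceq> neg (c n \<^bold>\<or> c (Suc n))"
    proof -
      have "c n \<^bold>\<or> c (Suc n) \<preceq> neg (d (Suc (Suc n)))"
        using layer_le_neg d by simp
      then have "neg (neg (d (Suc (Suc n)))) \<preceq> neg (c n \<^bold>\<or> c (Suc n))"
        using d by (intro neg_antimono) auto
      then show ?thesis using d by simp
    qed
    ultimately show ?thesis
      using t fixes_below_mono[OF t(3)] d by auto
  qed
  then obtain t where t: "\<And>n. t n \<in> carrier (heyting_Aut H)" "\<And>n. t n (c n) = c (Suc n)"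
      "\<And>n. fixes_below (t n) (neg (d n))" "\<And>n. fixes_below (t n) (d (Suc (Suc n)))"
    by metis
  \<comment> \<open>Thinning the sequence makes each pair of layers a single layer of
    \<open>D\<close>, on which the \<open>n\<close>-th swap is supported.\<close>
  define D where "D n = d (2 * n)" for n
  define f where "f n = t (2 * n)" for n
  have D: "converging D" unfolding D_def by (rule converging_subseq[OF d]) auto
  have f: "f n \<in> carrier (heyting_Aut H)" "fixes_below (f n) (neg (D n))"
    "fixes_below (f n) (D (Suc n))" for n
    using t[of "2 * n"] by (auto simp: f_def D_def)
  obtain s where s: "s \<in> carrier (heyting_Aut H)"
    "\<And>x. x \<in> carrier H \<Longrightarrow> \<exists>N. \<forall>m\<ge>N. s x = aut_prod f m x"
    using infinite_product[OF D f] by blast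
  have "s x = x" if "x \<in> carrier H" "x \<preceq> neg (d 0)" for x
    using s(2)[OF that(1)] aut_prod_off[OF D f, of x] that by (auto simp: D_def)
  moreover have "s (c (2 * n)) = c (2 * n + 1)" for n
  proof -
    obtain N where N: "\<And>m. m \<ge> N \<Longrightarrow> s (c (2 * n)) = aut_prod f m (c (2 * n))"
      using s(2)[of "c (2 * n)"] by auto
    \<comment> \<open>A stage beyond both \<open>N\<close> and \<open>n\<close>: there the finite
      product has the value of \<open>s\<close>, and on this layer it acts as its factor of index
      \<open>n\<close>.\<close>
    show ?thesis
      using N[of "max N (Suc n)"] aut_prod_block[OF D f, of "c (2 * n)" n "max N (Suc n)"]
        layer_le[of "2 * n" "2 * n"] layer_le_neg[of "2 * n" "2 * Suc n"] t(2)
      by (simp add: D_def) (simp add: f_def)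
  qed
  ultimately show ?thesis using that s(1) by (simp add: fixes_below_def)
qed

end

text \<open>A composite of two swaps: the first carries the layer \<open>2 * n\<close> to
  \<open>2 * n + 1\<close>, the second carries that one to \<open>2 * n + 2\<close>. The odd layers
  move inward to make room, so that the shift of the even layers is part of an automorphism.\<close>

lemma shift:
  assumes d: "converging d" and strict: "\<And>n. d (Suc n) \<noteq> d n"
  defines "c \<equiv> \<lambda>n. d n \<^bold>\<and> neg (d (Suc n))"
  obtains s where "s \<in> carrier (heyting_Aut H)" "fixes_below s (neg (d 0))"
    and "\<And>n. s (c (2 * n)) = c (2 * Suc n)"
proof -
  obtain s where s: "s \<in> carrier (heyting_Aut H)" "fixes_below s (neg (d 0))"
    "\<And>n. s (c (2 * n)) = c (2 * n + 1)"
    using even_swap[OF d strict] unfolding c_def by blast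
  \<comment> \<open>Without its first term the sequence has the odd layers of \<open>d\<close> as
    its even layers.\<close>
  have d': "converging (\<lambda>n. d (Suc n))" by (rule converging_subseq[OF d]) auto
  obtain r where r: "r \<in> carrier (heyting_Aut H)" "fixes_below r (neg (d (Suc 0)))"
    "\<And>n. r (c (2 * n + 1)) = c (2 * n + 2)"
    using even_swap[OF d' strict] unfolding c_def by auto
  have "fixes_below r (neg (d 0))"
    by (rule fixes_below_mono[OF r(2)])
      (use d converging_antimono[OF d, of 0 "Suc 0"] in \<open>auto intro: neg_antimono\<close>)
  then have "fixes_below (r \<odot> s) (neg (d 0))"
    using r s by (simp add: fixes_below_def)
  moreover have "(r \<odot> s) (c (2 * n)) = c (2 * Suc n)" for n
    using r s d by (simp add: c_def)
  ultimately show ?thesis using that[of "r \<odot> s"] r s by simp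
qed

text \<open>
  The infinite product \<open>F\<close> of the conjugates of \<open>f\<close> by the powers of the shift \<open>s\<close>
  absorbs \<open>f\<close>: \<open>F = f (s F s\<inverse>)\<close>.
\<close>

lemma commutator:
  assumes d: "converging d" and strict: "\<And>n. d (Suc n) \<noteq> d n"
    and f: "f \<in> carrier (heyting_Aut H)" "fixes_below f (neg (d 0 \<^bold>\<and> neg (d (Suc 0))))"
  obtains F s where "F \<in> carrier (heyting_Aut H)" "s \<in> carrier (heyting_Aut H)"
    "fixes_below F (neg (d 0))" "fixes_below s (neg (d 0))"
    "F = f \<odot> (s \<odot> F \<odot> inv\<^bsub>heyting_Aut H\<^esub> s)"
proof -
  define c where "c n = d n \<^bold>\<and> neg (d (Suc n))" for n
  have c: "c n \<in> complemented" for n using d by (simp add: c_def)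
  obtain s where s: "s \<in> carrier (heyting_Aut H)" "fixes_below s (neg (d 0))"
    "\<And>n. s (c (2 * n)) = c (2 * Suc n)"
    using shift[OF d strict] unfolding c_def by blast
  define i where "i = inv\<^bsub>heyting_Aut H\<^esub> s"
  have i: "i \<in> carrier (heyting_Aut H)" using s by (simp add: i_def)
  have si: "s (i x) = x" "i (s x) = x" if "x \<in> carrier H" for x
    using that s by (simp_all add: i_def)
  \<comment> \<open>\<open>fs n\<close> is the conjugate of \<open>f\<close> by the
    \<open>n\<close>-th power of \<open>s\<close>. As \<open>f\<close> is supported on
    \<open>c 0\<close>, it is supported on \<open>c (2 * n)\<close>.\<close>
  define fs where "fs = rec_nat f (\<lambda>_ g. s \<odot> g \<odot> i)"
  have fs_simps: "fs 0 = f" "\<And>n. fs (Suc n) = s \<odot> fs n \<odot> i" by (simp_all add: fs_def)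
  have fs: "fs n \<in> carrier (heyting_Aut H)" for n
    by (induction n) (simp_all add: fs_simps f s i)
  have fx: "fixes_below (fs n) (neg (c (2 * n)))" for n
  proof (induction n)
    case 0
    show ?case using f by (simp add: fs_simps c_def)
  next
    case (Suc n)
    show ?case unfolding fixes_below_def
    proof (intro ballI impI)
      fix x assume x: "x \<in> carrier H" "x \<preceq> neg (c (2 * Suc n))"
      have "s (i x) \<preceq> s (neg (c (2 * n)))" using x s c aut_neg[of s "c (2 * n)"] by (simp add: si)
      then have "i x \<preceq> neg (c (2 * n))" using s i x c by simp
      then have "fs n (i x) = i x" using fixes_belowD[OF Suc] i x by simp
      then show "fs (Suc n) x = x" using s i fs x by (simp add: fs_simps si)
    qed
  qed
  define D where "D n = d (2 * n)" for n
  have D: "converging D" unfolding D_def by (rule converging_subseq[OF d]) auto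
  have fx1: "fixes_below (fs n) (neg (D n))" for n
    by (rule fixes_below_mono[OF fx]) (use d c in \<open>auto simp: D_def c_def intro!: neg_antimono\<close>)
  have fx2: "fixes_below (fs n) (D (Suc n))" for n
  proof (rule fixes_below_mono[OF fx])
    have "c (2 * n) \<preceq> neg (d (2 * Suc n))"
      using layer_le_neg[OF d strict, of "2 * n" "2 * Suc n"] by (simp add: c_def)
    then have "neg (neg (d (2 * Suc n))) \<preceq> neg (c (2 * n))"
      using d c by (intro neg_antimono) auto
    then show "D (Suc n) \<preceq> neg (c (2 * n))" using d by (simp add: D_def)
  qed (use d c in \<open>auto simp: D_def\<close>)
  note prods = aut_prod_closed[OF D fs fx1 fx2]
  obtain F where F: "F \<in> carrier (heyting_Aut H)"
    "\<And>x. x \<in> carrier H \<Longrightarrow> \<exists>N. \<forall>m\<ge>N. F x = aut_prod fs m x"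
    using infinite_product[OF D fs fx1 fx2] by blast
  \<comment> \<open>The finite form of the absorption: conjugation by \<open>s\<close> raises every
    index by one, and \<open>f\<close> supplies the missing factor of index
    \<open>0\<close>.\<close>
  have step: "aut_prod fs (Suc m) x = f (s (aut_prod fs m (i x)))" if "x \<in> carrier H" for m x
    using that
  proof (induction m arbitrary: x)
    case 0
    then show ?case using f s i by (simp add: fs_simps si)
  next
    case (Suc m)
    have "aut_prod fs (Suc (Suc m)) x = aut_prod fs (Suc m) (fs (Suc m) x)"
      using Suc.prems fs prods by (simp only: aut_prod.simps aut_mult aut_closed Aut.m_closed)
    also have "\<dots> = f (s (aut_prod fs m (i (fs (Suc m) x))))"
      using Suc fs by (simp del: aut_prod.simps)
    also have "i (fs (Suc m) x) = fs m (i x)"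
      using Suc.prems s i fs by (simp add: fs_simps si)
    finally show ?case using Suc.prems fs prods i by simp
  qed
  have "F = f \<odot> (s \<odot> F \<odot> i)"
  proof (rule aut_eqI)
    fix x assume x: "x \<in> carrier H"
    obtain N M where NM: "\<And>m. m \<ge> N \<Longrightarrow> F x = aut_prod fs m x"
      "\<And>m. m \<ge> M \<Longrightarrow> F (i x) = aut_prod fs m (i x)"
      using F(2)[OF x] F(2)[of "i x"] i x by auto
    \<comment> \<open>The stage for \<open>x\<close> is one later than that for \<open>i x\<close>,
      to match \<open>step\<close>.\<close>
    have "F x = aut_prod fs (Suc (max N M)) x" "F (i x) = aut_prod fs (max N M) (i x)"
      using NM(1)[of "Suc (max N M)"] NM(2)[of "max N M"] by auto
    then have "F x = f (s (F (i x)))" using step[OF x, of "max N M"] by metis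
    moreover have "(f \<odot> (s \<odot> F \<odot> i)) x = f (s (F (i x)))" using x f s F(1) i by simp
    ultimately show "F x = (f \<odot> (s \<odot> F \<odot> i)) x" by (rule trans[OF _ sym])
  qed (use f s i F(1) in auto)
  moreover have "fixes_below F (neg (d 0))"
    using F(2) aut_prod_off[OF D fs fx1 fx2] unfolding fixes_below_def by (fastforce simp: D_def)
  ultimately show ?thesis using that F s unfolding i_def by blast
qed

end

section \<open>Commutators and conjugates\<close>

context group
begin

lemma conjugates_closed: "g \<in> carrier G \<Longrightarrow> conjugates G g \<subseteq> carrier G"
  by (auto simp: conjugates_def)

lemma conjugates_conj:
  assumes "g \<in> carrier G" "h \<in> carrier G" "x \<in> conjugates G g"
  shows "h \<otimes> x \<otimes> inv h \<in> conjugates G g"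
proof -
  obtain k where k: "k \<in> carrier G" "x = k \<otimes> g \<otimes> inv k"
    using assms(3) by (auto simp: conjugates_def)
  then have "h \<otimes> x \<otimes> inv h = (h \<otimes> k) \<otimes> g \<otimes> inv (h \<otimes> k)"
    using assms by (simp add: inv_mult_group m_assoc)
  then show ?thesis using k assms by (auto simp: conjugates_def)
qed

lemma foldr_append_mult:
  "\<lbrakk>set xs \<subseteq> carrier G; set ys \<subseteq> carrier G\<rbrakk> \<Longrightarrow>
    foldr (\<otimes>) xs \<one> \<in> carrier G
    \<and> foldr (\<otimes>) (xs @ ys) \<one> = foldr (\<otimes>) xs \<one> \<otimes> foldr (\<otimes>) ys \<one>"
proof (induction xs)
  case Nil
  have "foldr (\<otimes>) ys \<one> \<in> carrier G" using Nil(2) by (induction ys) auto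
  then show ?case by simp
next
  case (Cons x xs)
  have "foldr (\<otimes>) ys \<one> \<in> carrier G" using Cons(3) by (induction ys) auto
  then show ?case using Cons by (simp add: m_assoc)
qed

lemma product_of_at_most_mult:
  assumes C: "C \<subseteq> carrier G"
    and "product_of_at_most G m C x" "product_of_at_most G n C y"
  shows "product_of_at_most G (m + n) C (x \<otimes> y)"
proof -
  obtain xs ys where "length xs \<le> m" "set xs \<subseteq> C" "x = foldr (\<otimes>) xs \<one>"
    "length ys \<le> n" "set ys \<subseteq> C" "y = foldr (\<otimes>) ys \<one>"
    using assms(2,3) unfolding product_of_at_most_def by blast
  then show ?thesis
    using foldr_append_mult[of xs ys] C unfolding product_of_at_most_def
    by (intro exI[of _ "xs @ ys"]) auto
qed

lemma product_of_at_most_mono: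
  "\<lbrakk>product_of_at_most G m C x; m \<le> n\<rbrakk> \<Longrightarrow> product_of_at_most G n C x"
  unfolding product_of_at_most_def using le_trans by blast

lemma product_of_at_most_conj:
  assumes C: "C \<subseteq> carrier G" and inv: "\<And>z. z \<in> C \<Longrightarrow> h \<otimes> z \<otimes> inv h \<in> C"
    and h: "h \<in> carrier G" and "product_of_at_most G n C x"
  shows "product_of_at_most G n C (h \<otimes> x \<otimes> inv h)"
proof -
  obtain xs where xs: "length xs \<le> n" "set xs \<subseteq> C" "x = foldr (\<otimes>) xs \<one>"
    using assms(4) unfolding product_of_at_most_def by blast
  have "foldr (\<otimes>) (map (\<lambda>z. h \<otimes> z \<otimes> inv h) xs) \<one> = h \<otimes> foldr (\<otimes>) xs \<one> \<otimes> inv h"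
    using xs(2)
  proof (induction xs)
    case Nil
    then show ?case using h by simp
  next
    case (Cons z zs)
    have c: "z \<in> carrier G" "foldr (\<otimes>) zs \<one> \<in> carrier G"
      using Cons(2) C foldr_append_mult[of zs "[]"] by auto
    have "(h \<otimes> z \<otimes> inv h) \<otimes> (h \<otimes> foldr (\<otimes>) zs \<one> \<otimes> inv h)
        = h \<otimes> z \<otimes> ((inv h \<otimes> h) \<otimes> (foldr (\<otimes>) zs \<one> \<otimes> inv h))"
      using h c by (simp only: m_assoc m_closed inv_closed)
    then show ?case using Cons h c by (simp add: m_assoc)
  qed
  then show ?thesis
    using xs inv unfolding product_of_at_most_def
    by (intro exI[of _ "map (\<lambda>z. h \<otimes> z \<otimes> inv h) xs"]) auto
qed

text \<open>
  With \<open>f = F s F\<inverse> s\<inverse>\<close> and \<open>k = F (g F\<inverse> g\<inverse>) = (F g F\<inverse>) g\<inverse>\<close>, the second factor of \<open>k\<close>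
  commutes with \<open>s\<close>, so that also \<open>f = k s k\<inverse> s\<inverse>\<close>.
\<close>

lemma commutator_four_conjugates:
  assumes mem: "g \<in> carrier G" "f \<in> carrier G" "F \<in> carrier G" "s \<in> carrier G"
    and F: "F = f \<otimes> (s \<otimes> F \<otimes> inv s)"
    and comm: "(g \<otimes> inv F \<otimes> inv g) \<otimes> s = s \<otimes> (g \<otimes> inv F \<otimes> inv g)"
  shows "product_of_at_most G 4 (conjugates G g \<union> conjugates G (inv g)) f"
proof -
  let ?C = "conjugates G g \<union> conjugates G (inv g)"
  have l: "k \<otimes> g \<otimes> inv k \<in> ?C" "k \<otimes> inv g \<otimes> inv k \<in> ?C" if "k \<in> carrier G" for k
    using that by (auto simp: conjugates_def)
  have cancel: "inv x \<otimes> (x \<otimes> y) = y" "x \<otimes> (inv x \<otimes> y) = y" if "x \<in> carrier G" "y \<in> carrier G" for x y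
    using that by (simp_all flip: m_assoc)
  have f: "f = F \<otimes> (s \<otimes> inv F \<otimes> inv s)"
  proof -
    have "F \<otimes> (s \<otimes> inv F \<otimes> inv s) = f \<otimes> (s \<otimes> F \<otimes> inv s) \<otimes> (s \<otimes> inv F \<otimes> inv s)"
      using F by simp
    also have "\<dots> = f" using mem by (simp add: m_assoc cancel)
    finally show ?thesis by simp
  qed
  define M where "M = g \<otimes> inv F \<otimes> inv g"
  have M: "M \<in> carrier G" "M \<otimes> s = s \<otimes> M" using mem comm by (simp_all add: M_def)
  have Msi: "M \<otimes> (s \<otimes> inv M) = s"
  proof -
    have "M \<otimes> (s \<otimes> inv M) = (M \<otimes> s) \<otimes> inv M" using M(1) mem by (simp only: m_assoc inv_closed)
    also have "\<dots> = s" unfolding M(2) using M(1) mem by (simp add: m_assoc)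
    finally show ?thesis .
  qed
  have "f = F \<otimes> ((M \<otimes> (s \<otimes> inv M)) \<otimes> inv F \<otimes> inv s)"
    using f Msi by simp
  also have "\<dots> = (F \<otimes> M) \<otimes> (s \<otimes> inv (F \<otimes> M) \<otimes> inv s)"
    using mem M(1) by (simp add: m_assoc inv_mult_group)
  \<comment> \<open>The factor \<open>inv g\<close> is written as its conjugate by the unit, to fit
    the form in \<open>conjugates\<close>.\<close>
  also have "F \<otimes> M = (F \<otimes> g \<otimes> inv F) \<otimes> (\<one> \<otimes> inv g \<otimes> inv \<one>)"
    using mem by (simp add: M_def m_assoc)
  also have "inv \<dots> = g \<otimes> (F \<otimes> inv g \<otimes> inv F)"
    using mem by (simp add: inv_mult_group m_assoc)
  also have "s \<otimes> \<dots> \<otimes> inv s = (s \<otimes> g \<otimes> inv s) \<otimes> ((s \<otimes> F) \<otimes> inv g \<otimes> inv (s \<otimes> F))"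
    using mem by (simp add: inv_mult_group m_assoc cancel)
  finally have "f = foldr (\<otimes>) [F \<otimes> g \<otimes> inv F, \<one> \<otimes> inv g \<otimes> inv \<one>, s \<otimes> g \<otimes> inv s,
      (s \<otimes> F) \<otimes> inv g \<otimes> inv (s \<otimes> F)] \<one>" (is "_ = foldr _ ?cs _")
    using mem by (simp add: m_assoc)
  moreover have "set ?cs \<subseteq> ?C" 
    using l[of F] l[of \<one>] l[of s] l[of "s \<otimes> F"] mem by (simp only: list.set Un_iff m_closed one_closed) simp
  ultimately show ?thesis unfolding product_of_at_most_def by (intro exI[of _ ?cs]) simp
qed

end

section \<open>Displaced elements and the number of conjugates\<close>

context homogeneous_heyting
begin

text \<open>By density an element is determined by the complemented elements below it, so a
  nontrivial \<open>g\<close> moves some complemented \<open>c\<close>. The part of \<open>c\<close>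
  outside \<open>g c\<close>, or the part of \<open>g c\<close> outside \<open>c\<close>, is then
  nonzero and displaced.\<close>

lemma displaced:
  assumes g: "g \<in> carrier (heyting_Aut H)" "g \<noteq> \<one>\<^bsub>heyting_Aut H\<^esub>"
  obtains c where "c \<in> complemented" "c \<noteq> \<^bold>0" "c \<^bold>\<and> g c = \<^bold>0"
proof -
  have key: "\<exists>c\<in>complemented. \<not> c \<preceq> g c \<or> \<not> g c \<preceq> c"
  proof (rule ccontr)
    assume "\<not> ?thesis"
    then have fixd: "g c = c" if "c \<in> complemented" for c
      using that g(1) le_antisym[of "g c" c] by auto
    have "g x = x" if x: "x \<in> carrier H" for x
    proof -
      have iff: "c \<preceq> g x \<longleftrightarrow> c \<preceq> x" if "c \<in> complemented" for c
        using aut_le_iff[OF g(1), of c x] fixd that x by simp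
      show ?thesis
      proof (rule le_antisym)
        show "g x \<preceq> x" using dense[of "g x" x] iff x g(1) by auto
        show "x \<preceq> g x" using dense[of x "g x"] iff x g(1) by auto
      qed (use x g in auto)
    qed
    then have "g = \<one>\<^bsub>heyting_Aut H\<^esub>" using g(1) by (intro aut_eqI) auto
    then show False using g(2) by simp
  qed
  then obtain c where c: "c \<in> complemented" "\<not> c \<preceq> g c \<or> \<not> g c \<preceq> c" by blast
  have gc: "g c \<in> complemented" using c g by simp
  from c(2) show thesis
  proof
    assume n: "\<not> c \<preceq> g c"
    let ?d = "c \<^bold>\<and> neg (g c)"
    have "?d \<noteq> \<^bold>0" using meet_neg_top[of "g c" c] n c gc by auto
    moreover have "?d \<^bold>\<and> g ?d = \<^bold>0"
    proof (rule meet_disjoint[of _ "neg (g c)" _ "g c"])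
      show "g ?d \<preceq> g c" using g c gc by (subst aut_le_iff) auto
    qed (use c gc g in auto)
    ultimately show thesis using that[of ?d] c gc by auto
  next
    assume n: "\<not> g c \<preceq> c"
    let ?d = "g c \<^bold>\<and> neg c"
    have "?d \<noteq> \<^bold>0" using meet_neg_top[of c "g c"] n c gc by auto
    moreover have "?d \<^bold>\<and> g ?d = \<^bold>0"
    proof (rule meet_disjoint[of _ "g c" _ "neg (g c)"])
      have "g ?d \<preceq> g (neg c)" using g c gc by (subst aut_le_iff) auto
      then show "g ?d \<preceq> neg (g c)" using aut_neg[of g c] g c by simp
    qed (use c gc g in auto)
    ultimately show thesis using that[of ?d] c gc by auto
  qed
qed

text \<open>Conjugation brings the support of \<open>f\<close> into the first layer of a sequence
  inside an element \<open>c\<close> displaced by \<open>g\<close>. There \<open>commutator\<close>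
  applies, and conjugating \<open>F\<close> by \<open>g\<close> moves its support off
  \<open>c\<close>, as \<open>commutator_four_conjugates\<close> demands.\<close>

lemma four_conjugates:
  assumes g: "g \<in> carrier (heyting_Aut H)" "g \<noteq> \<one>\<^bsub>heyting_Aut H\<^esub>"
    and f: "f \<in> carrier (heyting_Aut H)" and e: "e \<in> complemented" "e \<noteq> \<^bold>0" "fixes_below f e"
  shows "product_of_at_most (heyting_Aut H) 4
    (conjugates (heyting_Aut H) g \<union> conjugates (heyting_Aut H) (inv\<^bsub>heyting_Aut H\<^esub> g)) f"
    (is "product_of_at_most _ _ ?C _")
proof -
  obtain e' where e': "e' \<in> complemented" "e' \<preceq> e" "e' \<noteq> \<^bold>0" "e' \<noteq> e"
    using shrink e by blast
  have fe': "fixes_below f e'" using fixes_below_mono e e' by blast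
  have "e' \<noteq> \<^bold>1" using e' e by auto
  then have ne': "neg e' \<noteq> \<^bold>0" "neg e' \<noteq> \<^bold>1"
    using e' neg_neg[of e'] by force+
  obtain c where c: "c \<in> complemented" "c \<noteq> \<^bold>0" "c \<^bold>\<and> g c = \<^bold>0"
    using displaced g by blast
  obtain d where d: "converging d" "d 0 = c" "\<And>n. d (Suc n) \<noteq> d n"
    using strict_converging c by blast
  define r where "r = d 0 \<^bold>\<and> neg (d (Suc 0))"
  have r: "r \<in> complemented" "r \<noteq> \<^bold>0" "r \<noteq> \<^bold>1"
    using layer_nonzero[OF d(1,3), of 0] layer_not_top[OF d(1,3), of 0] d(1) by (auto simp: r_def)
  obtain h where h: "h \<in> carrier (heyting_Aut H)" "h (neg e') = r"
    using homogeneous[of "neg e'" r] r ne' e' by auto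
  define i where "i = inv\<^bsub>heyting_Aut H\<^esub> h"
  have i: "i \<in> carrier (heyting_Aut H)" using h by (simp add: i_def)
  have hi: "h (i x) = x" "i (h x) = x" if "x \<in> carrier H" for x
    using that h by (simp_all add: i_def)
  have hr: "h e' = neg r" using aut_neg[OF h(1), of "neg e'"] h(2) e' by simp
  define f' where "f' = h \<odot> f \<odot> i"
  have f': "f' \<in> carrier (heyting_Aut H)" using f h i by (simp add: f'_def)
  have "fixes_below f' (neg r)"
    unfolding fixes_below_def
  proof (intro ballI impI)
    fix x assume x: "x \<in> carrier H" "x \<preceq> neg r"
    then have "h (i x) \<preceq> h e'" by (simp add: hi hr)
    then have "i x \<preceq> e'" using h i x e' by simp
    then have "f (i x) = i x" using fixes_belowD[OF fe'] i x by simp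
    then show "f' x = x" using f h i x by (simp add: f'_def hi)
  qed
  then obtain F s where Fs: "F \<in> carrier (heyting_Aut H)" "s \<in> carrier (heyting_Aut H)"
    "fixes_below F (neg c)" "fixes_below s (neg c)" "F = f' \<odot> (s \<odot> F \<odot> inv\<^bsub>heyting_Aut H\<^esub> s)"
    using commutator[OF d(1,3) f'] d(2) unfolding r_def by metis
  define j where "j = inv\<^bsub>heyting_Aut H\<^esub> g"
  define k where "k = inv\<^bsub>heyting_Aut H\<^esub> F"
  have jk: "j \<in> carrier (heyting_Aut H)" "k \<in> carrier (heyting_Aut H)"
    using g Fs by (simp_all add: j_def k_def)
  have gj: "g (j x) = x" if "x \<in> carrier H" for x
    using that g by (simp add: j_def)
  define M where "M = g \<odot> k \<odot> j"
  have M: "M \<in> carrier (heyting_Aut H)" using g jk by (simp add: M_def)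
  \<comment> \<open>\<open>M\<close> is supported on \<open>g c\<close>, which is disjoint from
    \<open>c\<close>, whereas \<open>s\<close> is supported on \<open>c\<close>.\<close>
  have "fixes_below M c"
    unfolding fixes_below_def
  proof (intro ballI impI)
    fix x assume x: "x \<in> carrier H" "x \<preceq> c"
    have "x \<^bold>\<and> g c = \<^bold>0" using meet_disjoint[of x c "g c" "g c"] x c g by simp
    then have "x \<preceq> g (neg c)" using x c g aut_neg[of g c] by (simp add: le_neg_iff)
    then have "g (j x) \<preceq> g (neg c)" using gj x by simp
    then have "j x \<preceq> neg c" using g jk x c by simp
    then have "F (j x) = j x" using fixes_belowD[OF Fs(3)] jk x by simp
    then have "k (j x) = j x" using aut_inv(1)[OF Fs(1), of "j x"] jk x by (simp add: k_def)
    then show "M x = x" using g jk x gj by (simp add: M_def)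
  qed
  then have "M \<odot> s = s \<odot> M"
    using disjoint_support_commute[OF Fs(2,4) M] c by blast
  then have P: "product_of_at_most (heyting_Aut H) 4 ?C f'"
    using Aut.commutator_four_conjugates[OF g(1) f' Fs(1,2,5)] by (simp add: M_def j_def k_def)
  have C: "?C \<subseteq> carrier (heyting_Aut H)" using Aut.conjugates_closed g(1) by simp
  \<comment> \<open>The set of conjugates is closed under conjugation, so the bound passes from
    \<open>f'\<close> back to \<open>f\<close>.\<close>
  have f_eq: "f = i \<odot> f' \<odot> inv\<^bsub>heyting_Aut H\<^esub> i"
    by (rule aut_eqI) (use f f' h i in \<open>simp_all add: f'_def i_def\<close>)
  show ?thesis
    by (subst f_eq, rule Aut.product_of_at_most_conj[OF C _ i P])
      (use Aut.conjugates_conj g(1) i in auto)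
qed

text \<open>Factor \<open>h\<close> as \<open>t\<close> times a map that is the identity below
  \<open>e\<close>, where \<open>t\<close> copies \<open>h\<close> below \<open>e\<close> and is the
  identity off \<open>e\<close> and its image. Each factor is the identity below some nonzero
  complemented element.\<close>

lemma eight_conjugates:
  assumes g: "g \<in> carrier (heyting_Aut H)" "g \<noteq> \<one>\<^bsub>heyting_Aut H\<^esub>"
    and h: "h \<in> carrier (heyting_Aut H)"
  shows "product_of_at_most (heyting_Aut H) 8
    (conjugates (heyting_Aut H) g \<union> conjugates (heyting_Aut H) (inv\<^bsub>heyting_Aut H\<^esub> g)) h"
    (is "product_of_at_most _ _ ?C _")
proof (cases "h = \<one>\<^bsub>heyting_Aut H\<^esub>")
  case True
  then show ?thesis unfolding product_of_at_most_def by (intro exI[of _ "[]"]) simp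
next
  case False
  then obtain c where c: "c \<in> complemented" "c \<noteq> \<^bold>0" "c \<^bold>\<and> h c = \<^bold>0"
    using displaced h by blast
  \<comment> \<open>With \<open>e\<close> strictly inside \<open>c\<close>, the rest of
    \<open>c\<close> lies outside both \<open>e\<close> and \<open>h e\<close>, so \<open>t\<close>
    fixes everything below a nonzero element.\<close>
  obtain e where e: "e \<in> complemented" "e \<preceq> c" "e \<noteq> \<^bold>0" "e \<noteq> c"
    using shrink[of c] c by blast
  have he: "h e \<preceq> h c" using e c h by simp
  have eh: "e \<^bold>\<and> h e = \<^bold>0" by (rule meet_disjoint[OF e(2) he c(3)]) (use e c h in auto)
  obtain t where t: "t \<in> carrier (heyting_Aut H)"
    "\<And>x. \<lbrakk>x \<in> carrier H; x \<preceq> e\<rbrakk> \<Longrightarrow> t x = h x" "fixes_below t (neg (e \<^bold>\<or> h e))"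
    using swap[OF h e(1) eh] by blast
  have "neg (e \<^bold>\<or> h e) \<noteq> \<^bold>0"
  proof
    assume "neg (e \<^bold>\<or> h e) = \<^bold>0"
    then have "c \<preceq> e \<^bold>\<or> h e" using meet_neg_top[of "e \<^bold>\<or> h e" c] e h c by simp
    then have "c = c \<^bold>\<and> (e \<^bold>\<or> h e)" by (simp add: meet_eq_left)
    also have "\<dots> = c \<^bold>\<and> e"
      using meet_disjoint[OF le_refl he c(3)] e c h by (simp add: distrib)
    finally have "c \<preceq> e" unfolding le_def by simp
    then show False using e c le_antisym by blast
  qed
  then have 1: "product_of_at_most (heyting_Aut H) 4 ?C t"
    using four_conjugates[OF g t(1) _ _ t(3)] e h by simp
  define k where "k = inv\<^bsub>heyting_Aut H\<^esub> t \<odot> h"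
  have k: "k \<in> carrier (heyting_Aut H)" using t h by (simp add: k_def)
  have "k x = x" if x: "x \<in> carrier H" "x \<preceq> e" for x
    using t(1) h x by (simp add: k_def flip: t(2)[OF x])
  then have "fixes_below k e" by (simp add: fixes_below_def)
  then have 2: "product_of_at_most (heyting_Aut H) 4 ?C k"
    using four_conjugates[OF g k e(1,3)] by blast
  have "h = t \<odot> k" by (rule aut_eqI) (use t h k in \<open>simp_all add: k_def\<close>)
  moreover have "?C \<subseteq> carrier (heyting_Aut H)" using Aut.conjugates_closed g(1) by simp
  ultimately show ?thesis using Aut.product_of_at_most_mult[OF _ 1 2] by simp
qed

lemma simple_Aut: "abstract_simple_group (heyting_Aut H)"
  unfolding abstract_simple_group_def
proof (intro conjI allI impI)
  show "group (heyting_Aut H)" by (rule group_heyting_Aut)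
  \<comment> \<open>An automorphism carrying \<open>u\<close> to its complement shows that the group
    is nontrivial.\<close>
  obtain u where u: "u \<in> complemented" "u \<noteq> \<^bold>0" "u \<noteq> \<^bold>1"
    using shrink[of "\<^bold>1"] nontrivial by auto
  have nu: "neg u \<noteq> \<^bold>0" "neg u \<noteq> \<^bold>1" "neg u \<noteq> u"
    using u neg_neg[of u] meet_neg[of u] by force+
  obtain h where "h \<in> carrier (heyting_Aut H)" "h u = neg u"
    using homogeneous[of u "neg u"] u nu by auto
  then show "carrier (heyting_Aut H) \<noteq> {\<one>\<^bsub>heyting_Aut H\<^esub>}"
    using nu(3) u(1) by (metis complemented_closed aut_one singletonD)
next
  fix N assume N: "N \<lhd> heyting_Aut H"
  interpret N: normal N "heyting_Aut H" by fact
  show "N = carrier (heyting_Aut H) \<or> N = {\<one>\<^bsub>heyting_Aut H\<^esub>}"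
  proof (rule disjCI)
    assume "N \<noteq> {\<one>\<^bsub>heyting_Aut H\<^esub>}"
    then obtain g where g: "g \<in> N" "g \<noteq> \<one>\<^bsub>heyting_Aut H\<^esub>" using N.one_closed by blast
    have C: "conjugates (heyting_Aut H) g \<union> conjugates (heyting_Aut H) (inv\<^bsub>heyting_Aut H\<^esub> g) \<subseteq> N"
      using g N.inv_op_closed2 by (auto simp: conjugates_def)
    have "h \<in> N" if h: "h \<in> carrier (heyting_Aut H)" for h
    proof -
      obtain cs where "set cs \<subseteq> N" "h = foldr (\<otimes>\<^bsub>heyting_Aut H\<^esub>) cs \<one>\<^bsub>heyting_Aut H\<^esub>"
        using eight_conjugates[OF N.mem_carrier[OF g(1)] g(2) h] C
        unfolding product_of_at_most_def by blast
      then show ?thesis by (induction cs arbitrary: h) auto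
    qed
    then show "N = carrier (heyting_Aut H)" using N.subset by blast
  qed
qed

end

section \<open>Complemented elements of the Fraisse limit\<close>

context heyting_algebra
begin

text \<open>The two sides are compared separately inside and outside \<open>u\<close>. The formula
  yields closure under implication for the subalgebra generated by a complemented element.\<close>

lemma imp_complemented:
  assumes "u \<in> complemented" "x \<in> carrier H"
  shows "u \<^bold>\<rightarrow> x = neg u \<^bold>\<or> x"
proof (rule le_antisym)
  have u: "u \<in> carrier H" using assms by simp
  have "(u \<^bold>\<rightarrow> x) \<^bold>\<and> u \<preceq> x" using imp_adjoint[of u x "u \<^bold>\<rightarrow> x"] assms u by simp
  then have 1: "(u \<^bold>\<rightarrow> x) \<^bold>\<and> u \<preceq> neg u \<^bold>\<or> x" using le_trans[OF _ join_ge2] assms u by simp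
  have 2: "(u \<^bold>\<rightarrow> x) \<^bold>\<and> neg u \<preceq> neg u \<^bold>\<or> x"
    using le_trans[OF meet_le2 join_ge1] assms u by simp
  show "u \<^bold>\<rightarrow> x \<preceq> neg u \<^bold>\<or> x" using le_by_complemented[OF assms(1) _ _ 1 2] assms u by simp
  show "neg u \<^bold>\<or> x \<preceq> u \<^bold>\<rightarrow> x" using assms u by (subst imp_adjoint) (auto simp: distrib2)
qed (use assms in auto)

lemma restrict_heyting:
  assumes "subuniverse H S"
  shows "heyting_algebra (H\<lparr>carrier := S\<rparr>)"
proof -
  have c: "x \<in> carrier H" if "x \<in> S" for x using assms that by (auto simp: subuniverse_def)
  show ?thesis
    by unfold_locales
      ((simp, rule meet_comm join_comm meet_assoc join_assoc meet_absorb join_absorb residuation;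
          simp add: c)
        | (use assms c in \<open>simp add: subuniverse_def\<close>))+
qed

lemma le_restrict:
  assumes "subuniverse H S"
  shows "heyting_algebra.le (H\<lparr>carrier := S\<rparr>) x y \<longleftrightarrow> x \<preceq> y"
  by (simp add: heyting_algebra.le_def[OF restrict_heyting[OF assms]] le_def)

lemma subuniverse_carrier: "subuniverse H (carrier H)"
  by (simp add: subuniverse_def)

lemma subuniverse_generated:
  assumes "X \<subseteq> carrier H"
  shows "subuniverse H (generated_subuniverse H X)"
  using subuniverse_carrier assms unfolding subuniverse_def generated_subuniverse_def by blast

lemma fg_substructure_finite:
  assumes "subuniverse H S" "finite S"
  shows "H\<lparr>carrier := S\<rparr> \<in> fg_substructures H"
proof -
  have "generated_subuniverse H S = S"
    using assms(1) unfolding generated_subuniverse_def by blast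
  then show ?thesis
    using assms unfolding fg_substructures_def subuniverse_def by (intro CollectI exI[of _ S]) simp
qed

text \<open>The elements \<open>u\<close> and \<open>v\<close> generate four-element Boolean
  subalgebras; the isomorphism between these that sends \<open>u\<close> to \<open>v\<close> extends
  to an automorphism.\<close>

lemma ultrahomogeneous_complemented:
  assumes uh: "ultrahomogeneous H"
    and u: "u \<in> complemented" "u \<noteq> \<^bold>0" "u \<noteq> \<^bold>1" and v: "v \<in> complemented" "v \<noteq> \<^bold>0" "v \<noteq> \<^bold>1"
  shows "\<exists>h\<in>carrier (heyting_Aut H). h u = v"
proof -
  define S where "S w = {\<^bold>0, w, neg w, \<^bold>1}" for w
  have sub: "subuniverse H (S w)" if "w \<in> complemented" for w
    unfolding S_def subuniverse_def using that by (simp add: imp_complemented)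
  have tab: "neg w \<noteq> \<^bold>0" "neg w \<noteq> \<^bold>1" "neg w \<noteq> w" "w \<noteq> neg w" "\<not> w \<preceq> neg w" "\<not> neg w \<preceq> w"
    if w: "w \<in> complemented" "w \<noteq> \<^bold>0" "w \<noteq> \<^bold>1" for w
  proof -
    show 1: "neg w \<noteq> \<^bold>0" "neg w \<noteq> \<^bold>1" using w by (metis bounds_complemented(3,4) neg_neg)+
    show 2: "\<not> w \<preceq> neg w" using w by (simp add: le_neg_iff)
    then show "neg w \<noteq> w" "w \<noteq> neg w" using w by auto
    show "\<not> neg w \<preceq> w" using le_neg_iff[of "neg w" "neg w"] 1 w by simp
  qed
  define f where "f x = (if x = \<^bold>0 then \<^bold>0 else if x = u then v else if x = neg u then neg v else \<^bold>1)" for x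
  have 01: "\<^bold>0 \<noteq> \<^bold>1" using u bot_le le_top by (metis complemented_closed le_bot_iff)
  have "f \<in> heyting_iso (H\<lparr>carrier := S u\<rparr>) (H\<lparr>carrier := S v\<rparr>)"
  proof (rule heyting_isoI_order)
    show "bij_betw f (carrier (H\<lparr>carrier := S u\<rparr>)) (carrier (H\<lparr>carrier := S v\<rparr>))"
      using u v 01 tab[OF u] tab[OF v] by (auto simp: bij_betw_def inj_on_def S_def f_def)
  next
    fix x y assume xy: "x \<in> carrier (H\<lparr>carrier := S u\<rparr>)" "y \<in> carrier (H\<lparr>carrier := S u\<rparr>)"
    have "x \<preceq> y \<longleftrightarrow> f x \<preceq> f y"
      using xy u v 01 tab[OF u] tab[OF v] by (auto simp: S_def f_def)
    then show "heyting_algebra.le (H\<lparr>carrier := S u\<rparr>) x y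
        \<longleftrightarrow> heyting_algebra.le (H\<lparr>carrier := S v\<rparr>) (f x) (f y)"
      using le_restrict[OF sub] u v by simp
  qed (use restrict_heyting sub u v in auto)
  moreover have "H\<lparr>carrier := S u\<rparr> \<in> fg_substructures H" "H\<lparr>carrier := S v\<rparr> \<in> fg_substructures H"
    using fg_substructure_finite sub u v by (auto simp: S_def)
  ultimately obtain g where "g \<in> heyting_auto H" "\<forall>x\<in>S u. g x = f x"
    using uh unfolding ultrahomogeneous_def by fastforce
  then show ?thesis using u by (auto simp: carrier_Aut S_def f_def)
qed

end

text \<open>An embedding is an isomorphism onto its image with the operations of \<open>B\<close>.
  The record update replaces the carrier by any set whatsoever, so the inclusion in the carrier of
  \<open>B\<close> is stated separately.\<close>

definition heyting_embedding :: "'a heyting \<Rightarrow> 'b heyting \<Rightarrow> ('a \<Rightarrow> 'b) set" where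
  "heyting_embedding A B =
    {f. f ` carrier A \<subseteq> carrier B \<and> f \<in> heyting_iso A (B\<lparr>carrier := f ` carrier A\<rparr>)}"

lemma heyting_embedding_comp:
  assumes "f \<in> heyting_embedding A B" "g \<in> heyting_embedding B C"
  shows "g \<circ> f \<in> heyting_embedding A C"
proof -
  have c: "f x \<in> carrier B" if "x \<in> carrier A" for x
    using assms(1) that by (auto simp: heyting_embedding_def)
  have "inj_on g (f ` carrier A)"
    using assms by (auto simp: heyting_embedding_def heyting_iso_def bij_betw_def intro: inj_on_subset)
  then show ?thesis
    using assms c by (auto simp: heyting_embedding_def heyting_iso_def bij_betw_def intro!: comp_inj_on)
qed

lemma heyting_embedding_iso: 
  assumes "f \<in> heyting_iso A B"
  shows "f \<in> heyting_embedding A B"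
proof -
  have "f ` carrier A = carrier B" using assms by (auto simp: heyting_iso_def bij_betw_def)
  then show ?thesis using assms by (simp add: heyting_embedding_def)
qed

lemma heyting_embedding_subuniverse:
  assumes A: "heyting_algebra A" and f: "f \<in> heyting_embedding A B"
  shows "subuniverse B (f ` carrier A)"
proof -
  interpret A: heyting_algebra A by fact
  have "f \<^bold>0\<^bsub>A\<^esub> = \<^bold>0\<^bsub>B\<^esub>" "f \<^bold>1\<^bsub>A\<^esub> = \<^bold>1\<^bsub>B\<^esub>"
    "\<And>x y. \<lbrakk>x \<in> carrier A; y \<in> carrier A\<rbrakk> \<Longrightarrow> f x \<^bold>\<and>\<^bsub>B\<^esub> f y = f (x \<^bold>\<and>\<^bsub>A\<^esub> y)
      \<and> f x \<^bold>\<or>\<^bsub>B\<^esub> f y = f (x \<^bold>\<or>\<^bsub>A\<^esub> y) \<and> f x \<^bold>\<rightarrow>\<^bsub>B\<^esub> f y = f (x \<^bold>\<rightarrow>\<^bsub>A\<^esub> y)"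
    using f by (auto simp: heyting_embedding_def heyting_iso_def)
  then show ?thesis
    using f unfolding subuniverse_def heyting_embedding_def
    by (auto intro: rev_image_eqI[OF A.bot_closed] rev_image_eqI[OF A.top_closed])
qed

section \<open>Transport of structure and products with an interval\<close>

definition heyting_image :: "('a \<Rightarrow> 'b) \<Rightarrow> 'a heyting \<Rightarrow> 'b heyting" where
  "heyting_image f A = (let g = inv_into (carrier A) f in
    \<lparr>carrier = f ` carrier A, hbot = f \<^bold>0\<^bsub>A\<^esub>, htop = f \<^bold>1\<^bsub>A\<^esub>,
     hmeet = (\<lambda>x y. f (g x \<^bold>\<and>\<^bsub>A\<^esub> g y)), hjoin = (\<lambda>x y. f (g x \<^bold>\<or>\<^bsub>A\<^esub> g y)),
     himp = (\<lambda>x y. f (g x \<^bold>\<rightarrow>\<^bsub>A\<^esub> g y))\<rparr>)"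

text \<open>Used to copy a finite algebra onto a set of natural numbers.\<close>

lemma heyting_image:
  assumes A: "heyting_algebra A" and inj: "inj_on f (carrier A)"
  shows "heyting_algebra (heyting_image f A)" "f \<in> heyting_iso A (heyting_image f A)"
proof -
  interpret A: heyting_algebra A by fact
  have inv: "inv_into (carrier A) f (f x) = x" if "x \<in> carrier A" for x
    using inj that by simp
  have eq: "f x = f y \<longleftrightarrow> x = y" if "x \<in> carrier A" "y \<in> carrier A" for x y
    using inj that by (auto simp: inj_on_def)
  show "heyting_algebra (heyting_image f A)"
    by unfold_locales
      (auto simp: heyting_image_def Let_def inv eq A.meet_absorb A.join_absorb A.residuation
        intro: A.meet_comm A.join_comm A.meet_assoc A.join_assoc)
  show "f \<in> heyting_iso A (heyting_image f A)"
    using inj by (auto simp: heyting_iso_def heyting_image_def Let_def bij_betw_def inv)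
qed

definition interval_product :: "'a heyting \<Rightarrow> 'a \<Rightarrow> ('a \<times> 'a) heyting" where
  "interval_product H a =
    \<lparr>carrier = {p. fst p \<in> carrier H \<and> snd p \<in> carrier H \<and> snd p \<^bold>\<and>\<^bsub>H\<^esub> a = snd p},
     hbot = (\<^bold>0\<^bsub>H\<^esub>, \<^bold>0\<^bsub>H\<^esub>), htop = (\<^bold>1\<^bsub>H\<^esub>, a),
     hmeet = (\<lambda>p q. (fst p \<^bold>\<and>\<^bsub>H\<^esub> fst q, snd p \<^bold>\<and>\<^bsub>H\<^esub> snd q)),
     hjoin = (\<lambda>p q. (fst p \<^bold>\<or>\<^bsub>H\<^esub> fst q, snd p \<^bold>\<or>\<^bsub>H\<^esub> snd q)),
     himp = (\<lambda>p q. (fst p \<^bold>\<rightarrow>\<^bsub>H\<^esub> fst q, (snd p \<^bold>\<rightarrow>\<^bsub>H\<^esub> snd q) \<^bold>\<and>\<^bsub>H\<^esub> a))\<rparr>"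

context heyting_algebra
begin

lemma interval_product_heyting:
  assumes a: "a \<in> carrier H"
  shows "heyting_algebra (interval_product H a)"
proof -
  have meet: "(x \<^bold>\<and> y) \<^bold>\<and> a = x \<^bold>\<and> y" if "x \<in> carrier H" "y \<in> carrier H" "y \<^bold>\<and> a = y" for x y
    using that a by (simp add: meet_assoc)
  have join: "(x \<^bold>\<or> y) \<^bold>\<and> a = x \<^bold>\<or> y"
    if "x \<in> carrier H" "y \<in> carrier H" "x \<^bold>\<and> a = x" "y \<^bold>\<and> a = y" for x y
    using that a by (simp add: distrib2)
  have imp: "(x \<^bold>\<and> a) \<^bold>\<and> a = x \<^bold>\<and> a" if "x \<in> carrier H" for x
    using that a by (simp add: meet_assoc)
  have res: "(z \<^bold>\<and> x) \<^bold>\<and> y = z \<^bold>\<and> x \<longleftrightarrow> z \<^bold>\<and> ((x \<^bold>\<rightarrow> y) \<^bold>\<and> a) = z"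
    if "x \<in> carrier H" "y \<in> carrier H" "z \<in> carrier H" "z \<^bold>\<and> a = z" for x y z
  proof -
    have "z \<preceq> a" using that by (simp add: le_def)
    then have "z \<preceq> x \<^bold>\<rightarrow> y \<longleftrightarrow> z \<preceq> (x \<^bold>\<rightarrow> y) \<^bold>\<and> a" using that a by simp
    then show ?thesis using that residuation[of x y z] by (simp add: le_def)
  qed
  show ?thesis
    by unfold_locales
      (auto simp: interval_product_def a meet join imp res residuation meet_absorb join_absorb
        intro: meet_comm join_comm meet_assoc join_assoc)
qed

lemma interval_product_embedding:
  assumes a: "a \<in> carrier H"
  shows "(\<lambda>x. (x, x \<^bold>\<and> a)) \<in> heyting_embedding H (interval_product H a)"
proof -
  have idem: "(x \<^bold>\<and> a) \<^bold>\<and> a = x \<^bold>\<and> a" if "x \<in> carrier H" for x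
    using that a by (simp add: meet_assoc)
  have meet: "(x \<^bold>\<and> y) \<^bold>\<and> a = (x \<^bold>\<and> a) \<^bold>\<and> (y \<^bold>\<and> a)" if "x \<in> carrier H" "y \<in> carrier H" for x y
    by (rule le_antisym) (use that a in \<open>auto intro: le_trans[OF meet_le1] le_trans[OF meet_le2]\<close>)
  have imp: "(x \<^bold>\<rightarrow> y) \<^bold>\<and> a = ((x \<^bold>\<and> a) \<^bold>\<rightarrow> (y \<^bold>\<and> a)) \<^bold>\<and> a"
    if xy: "x \<in> carrier H" "y \<in> carrier H" for x y
  proof -
    have "z \<preceq> (x \<^bold>\<rightarrow> y) \<^bold>\<and> a \<longleftrightarrow> z \<preceq> ((x \<^bold>\<and> a) \<^bold>\<rightarrow> (y \<^bold>\<and> a)) \<^bold>\<and> a" if z: "z \<in> carrier H" for z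
    proof (cases "z \<preceq> a")
      case True
      have "z \<^bold>\<and> (x \<^bold>\<and> a) = (z \<^bold>\<and> a) \<^bold>\<and> x"
        using xy z a meet_comm[of x a] by (simp add: meet_assoc)
      then have "z \<^bold>\<and> (x \<^bold>\<and> a) = z \<^bold>\<and> x" using True by (simp add: meet_eq_left)
      moreover have "z \<^bold>\<and> x \<preceq> a" using True le_trans[OF meet_le1 True] xy z a by simp
      ultimately show ?thesis using True xy z a by (simp add: imp_adjoint)
    qed (use xy z a in simp)
    then show ?thesis using xy a by (meson imp_closed le_antisym le_refl meet_closed)
  qed
  show ?thesis
    using a by (auto simp: heyting_embedding_def heyting_iso_def interval_product_def bij_betw_def
        inj_on_def idem distrib2 meet[symmetric] imp[symmetric])
qed

end

section \<open>Extension property of the limit and density of complemented elements\<close>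

lemma fraisse_embedding:
  fixes L :: "'a heyting" and P :: "'b heyting"
  assumes L: "heyting_fraisse_limit L" and P: "finite_nontrivial_heyting P"
  shows "\<exists>f. f \<in> heyting_embedding P L"
proof -
  interpret L: heyting_algebra L using L by (simp add: heyting_fraisse_limit_def)
  have fin: "finite (carrier P)" "heyting_algebra P" using P by (auto simp: finite_nontrivial_heyting_def)
  \<comment> \<open>The defining clause of the limit speaks of algebras on natural numbers, so
    \<open>P\<close> is first copied to one.\<close>
  obtain e :: "'b \<Rightarrow> nat" where e: "inj_on e (carrier P)"
    using finite_imp_inj_to_nat_seg[OF fin(1)] by blast
  let ?N = "heyting_image e P"
  note N = heyting_image[OF fin(2) e]
  have "finite (carrier ?N)" "hbot ?N \<noteq> htop ?N"
    using fin(1) P e heyting_algebra.bot_closed[OF fin(2)] heyting_algebra.top_closed[OF fin(2)]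
    by (auto simp: heyting_image_def Let_def finite_nontrivial_heyting_def inj_on_def)
  then have "finite_nontrivial_heyting ?N" using N(1) by (simp add: finite_nontrivial_heyting_def)
  then obtain B f where B: "B \<in> fg_substructures L" "f \<in> heyting_iso ?N B"
    using L unfolding heyting_fraisse_limit_def by blast
  then obtain X where X: "X \<subseteq> carrier L" "B = L\<lparr>carrier := generated_subuniverse L X\<rparr>"
    unfolding fg_substructures_def by blast
  have "carrier B \<subseteq> carrier L"
    using L.subuniverse_generated[OF X(1)] X(2) by (simp add: subuniverse_def)
  then have "f \<in> heyting_embedding ?N L"
    using heyting_embedding_iso[OF B(2)] X(2) by (auto simp: heyting_embedding_def)
  then show ?thesis
    using heyting_embedding_comp heyting_embedding_iso[OF N(2)] by blast
qed

text \<open>The set \<open>S\<close> and its image under \<open>f\<close> after \<open>e\<close> are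
  isomorphic finite subalgebras of \<open>L\<close>, and ultrahomogeneity supplies \<open>g\<close>.
  Following \<open>f\<close> by the inverse of \<open>g\<close> thus embeds \<open>P\<close> into
  \<open>L\<close> compatibly with the inclusion of \<open>S\<close>.\<close>

lemma fraisse_extension:
  fixes L :: "'a heyting" and P :: "'b heyting"
  assumes L: "heyting_fraisse_limit L" and S: "subuniverse L S" "finite S"
    and P: "finite_nontrivial_heyting P" and e: "e \<in> heyting_embedding (L\<lparr>carrier := S\<rparr>) P"
  obtains f g where "f \<in> heyting_embedding P L" "g \<in> heyting_auto L" "\<And>x. x \<in> S \<Longrightarrow> g x = f (e x)"
proof -
  interpret L: heyting_algebra L using L by (simp add: heyting_fraisse_limit_def)
  obtain f where f: "f \<in> heyting_embedding P L" using fraisse_embedding[OF L P] by blast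
  let ?A = "L\<lparr>carrier := S\<rparr>" and ?T = "(f \<circ> e) ` S"
  have fe: "f \<circ> e \<in> heyting_embedding ?A L" using heyting_embedding_comp[OF e f] .
  have "subuniverse L ?T"
    using heyting_embedding_subuniverse[OF L.restrict_heyting[OF S(1)] fe] by simp
  then have "L\<lparr>carrier := ?T\<rparr> \<in> fg_substructures L" "?A \<in> fg_substructures L"
    using L.fg_substructure_finite S by auto
  moreover have "f \<circ> e \<in> heyting_iso ?A (L\<lparr>carrier := ?T\<rparr>)"
    using fe by (simp add: heyting_embedding_def)
  moreover have "ultrahomogeneous L" using L by (simp add: heyting_fraisse_limit_def)
  ultimately obtain g where "g \<in> heyting_auto L" "\<forall>x\<in>carrier ?A. g x = (f \<circ> e) x"
    unfolding ultrahomogeneous_def by blast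
  then show ?thesis using that f by simp
qed

lemma fraisse_dense:
  fixes L :: "'a heyting"
  assumes L: "heyting_fraisse_limit L"
    and ab: "a \<in> carrier L" "b \<in> carrier L" "\<not> heyting_algebra.le L a b"
  shows "\<exists>c\<in>heyting_algebra.complemented L. heyting_algebra.le L c a \<and> \<not> heyting_algebra.le L c b \<and> c \<noteq> a"
proof -
  interpret L: heyting_algebra L using L by (simp add: heyting_fraisse_limit_def)
  define S where "S = generated_subuniverse L {a, b}"
  have S: "subuniverse L S" unfolding S_def using ab by (intro L.subuniverse_generated) simp
  have abS: "a \<in> S" "b \<in> S" by (auto simp: S_def generated_subuniverse_def)
  let ?A = "L\<lparr>carrier := S\<rparr>"
  have "?A \<in> fg_substructures L" using ab unfolding fg_substructures_def S_def by blast
  then have A: "finite_nontrivial_heyting ?A" using L by (simp add: heyting_fraisse_limit_def)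
  then have fin: "finite S" "\<^bold>0\<^bsub>L\<^esub> \<noteq> \<^bold>1\<^bsub>L\<^esub>" by (auto simp: finite_nontrivial_heyting_def)
  interpret A: heyting_algebra ?A using A by (simp add: finite_nontrivial_heyting_def)
  let ?P = "interval_product ?A a"
  have aA: "a \<in> carrier ?A" using abS by simp
  have "carrier ?P \<subseteq> S \<times> S" by (auto simp: interval_product_def)
  then have "finite (carrier ?P)" using fin(1) by (meson finite_SigmaI finite_subset)
  then have P: "finite_nontrivial_heyting ?P"
    using A.interval_product_heyting[OF aA] fin(2)
    by (simp add: finite_nontrivial_heyting_def interval_product_def)
  obtain f g where f: "f \<in> heyting_embedding ?P L" and g: "g \<in> heyting_auto L"
    and fg: "\<And>x. x \<in> S \<Longrightarrow> g x = f (x, x \<^bold>\<and>\<^bsub>L\<^esub> a)"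
    using fraisse_extension[OF L S fin(1) P A.interval_product_embedding[OF aA]] by auto
  have gA: "g \<in> carrier (heyting_Aut L)" using g by (simp add: L.carrier_Aut)
  have S01: "\<^bold>0\<^bsub>L\<^esub> \<in> S" "\<^bold>1\<^bsub>L\<^esub> \<in> S" using S by (auto simp: subuniverse_def)
  have abm: "a \<^bold>\<and>\<^bsub>L\<^esub> b \<in> S" "b \<^bold>\<and>\<^bsub>L\<^esub> a \<in> S" using S abS by (auto simp: subuniverse_def)
  have mem: "(\<^bold>0\<^bsub>L\<^esub>, a) \<in> carrier ?P" "(\<^bold>1\<^bsub>L\<^esub>, \<^bold>0\<^bsub>L\<^esub>) \<in> carrier ?P" "(a, a) \<in> carrier ?P"
    "(b, b \<^bold>\<and>\<^bsub>L\<^esub> a) \<in> carrier ?P" "(\<^bold>0\<^bsub>L\<^esub>, b \<^bold>\<and>\<^bsub>L\<^esub> a) \<in> carrier ?P"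
    using S01 abS abm ab by (auto simp: interval_product_def L.meet_assoc)
  have inj: "inj_on f (carrier ?P)" and fP: "f ` carrier ?P \<subseteq> carrier L"
    using f by (auto simp: heyting_embedding_def heyting_iso_def bij_betw_def)
  have hom: "f (p \<^bold>\<and>\<^bsub>?P\<^esub> q) = f p \<^bold>\<and>\<^bsub>L\<^esub> f q" "f (p \<^bold>\<or>\<^bsub>?P\<^esub> q) = f p \<^bold>\<or>\<^bsub>L\<^esub> f q"
    if "p \<in> carrier ?P" "q \<in> carrier ?P" for p q
    using f that by (auto simp: heyting_embedding_def heyting_iso_def)
  have bounds: "f (\<^bold>0\<^bsub>L\<^esub>, \<^bold>0\<^bsub>L\<^esub>) = \<^bold>0\<^bsub>L\<^esub>" "f (\<^bold>1\<^bsub>L\<^esub>, a) = \<^bold>1\<^bsub>L\<^esub>"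
    using f by (auto simp: heyting_embedding_def heyting_iso_def interval_product_def)
  define c where "c = f (\<^bold>0\<^bsub>L\<^esub>, a)"
  have cL: "c \<in> carrier L" "f (\<^bold>1\<^bsub>L\<^esub>, \<^bold>0\<^bsub>L\<^esub>) \<in> carrier L" using fP mem by (auto simp: c_def)
  have "c \<^bold>\<and>\<^bsub>L\<^esub> f (\<^bold>1\<^bsub>L\<^esub>, \<^bold>0\<^bsub>L\<^esub>) = \<^bold>0\<^bsub>L\<^esub>" "c \<^bold>\<or>\<^bsub>L\<^esub> f (\<^bold>1\<^bsub>L\<^esub>, \<^bold>0\<^bsub>L\<^esub>) = \<^bold>1\<^bsub>L\<^esub>"
    using hom[OF mem(1,2)] ab bounds by (auto simp: c_def interval_product_def)
  then have c: "c \<in> L.complemented" using L.complement_unique cL by blast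
  have ga: "g a = f (a, a)" and gb: "g b = f (b, b \<^bold>\<and>\<^bsub>L\<^esub> a)" using fg abS ab by auto
  have 1: "L.le c (g a)"
    using hom(1)[OF mem(1,3)] ab by (simp add: L.le_def c_def ga interval_product_def)
  have ne: "b \<^bold>\<and>\<^bsub>L\<^esub> a \<noteq> a" using ab L.meet_comm[of a b] by (simp add: L.le_def)
  have a0: "a \<noteq> \<^bold>0\<^bsub>L\<^esub>" using ab by auto
  have 2: "\<not> L.le c (g b)"
  proof
    assume "L.le c (g b)"
    then have "f (\<^bold>0\<^bsub>L\<^esub>, a \<^bold>\<and>\<^bsub>L\<^esub> (b \<^bold>\<and>\<^bsub>L\<^esub> a)) = f (\<^bold>0\<^bsub>L\<^esub>, a)"
      using hom(1)[OF mem(1,4)] ab by (simp add: L.le_def c_def gb interval_product_def)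
    moreover have "a \<^bold>\<and>\<^bsub>L\<^esub> (b \<^bold>\<and>\<^bsub>L\<^esub> a) = b \<^bold>\<and>\<^bsub>L\<^esub> a"
      using ab L.meet_comm[of a "b \<^bold>\<and>\<^bsub>L\<^esub> a"] by (simp add: L.meet_assoc)
    ultimately show False using inj_onD[OF inj _ mem(5,1)] ne by simp
  qed
  have 3: "c \<noteq> g a" using inj_onD[OF inj _ mem(1,3)] a0 by (auto simp: c_def ga)
  \<comment> \<open>The element \<open>c\<close> was found relative to \<open>g a\<close> and
    \<open>g b\<close>; the inverse of \<open>g\<close> brings it back to \<open>a\<close> and
    \<open>b\<close>.\<close>
  define i where "i = inv\<^bsub>heyting_Aut L\<^esub> g"
  have i: "i \<in> carrier (heyting_Aut L)" "\<And>x. x \<in> carrier L \<Longrightarrow> i (g x) = x" 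
    "\<And>x. x \<in> carrier L \<Longrightarrow> g (i x) = x"
    using gA by (auto simp: i_def)
  show ?thesis
  proof (intro bexI conjI)
    show "i c \<in> L.complemented" using L.aut_complemented i c by blast
    show "L.le (i c) a" using L.aut_le_iff[OF i(1), of c "g a"] 1 i(2) ab cL gA by simp
    show "\<not> L.le (i c) b" using L.aut_le_iff[OF i(1), of c "g b"] 2 i(2) ab cL gA by simp
    show "i c \<noteq> a" using 3 i cL by metis
  qed
qed

lemma fraisse_homogeneous_heyting:
  assumes L: "heyting_fraisse_limit L"
  shows "homogeneous_heyting L"
proof -
  interpret L: heyting_algebra L using L by (simp add: heyting_fraisse_limit_def)
  \<comment> \<open>The subalgebra generated by the empty set has the bounds of \<open>L\<close>, so
    its nontriviality is that of \<open>L\<close>.\<close>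
  have "L\<lparr>carrier := generated_subuniverse L {}\<rparr> \<in> fg_substructures L"
    unfolding fg_substructures_def by blast
  then have "finite_nontrivial_heyting (L\<lparr>carrier := generated_subuniverse L {}\<rparr>)"
    using L unfolding heyting_fraisse_limit_def by blast
  then have "\<^bold>0\<^bsub>L\<^esub> \<noteq> \<^bold>1\<^bsub>L\<^esub>" by (simp add: finite_nontrivial_heyting_def)
  then show ?thesis
    using L L.ultrahomogeneous_complemented fraisse_dense[OF L]
    by unfold_locales (auto simp: heyting_fraisse_limit_def)
qed

theorem corollary3p7:
  fixes L :: "'a heyting"
  assumes "heyting_fraisse_limit L"
  shows "abstract_simple_group (heyting_Aut L)
    \<and> (\<forall>g\<in>carrier (heyting_Aut L). g \<noteq> \<one>\<^bsub>heyting_Aut L\<^esub> \<longrightarrow>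
        (\<forall>h\<in>carrier (heyting_Aut L).
          product_of_at_most (heyting_Aut L) 16
            (conjugates (heyting_Aut L) g
              \<union> conjugates (heyting_Aut L) (inv\<^bsub>heyting_Aut L\<^esub> g)) h))"
proof -
  interpret homogeneous_heyting L by (rule fraisse_homogeneous_heyting[OF assms])
  show ?thesis
    \<comment> \<open>The bound eight is weakened to the stated sixteen.\<close>
    using simple_Aut eight_conjugates Aut.product_of_at_most_mono[of 8 _ _ 16] by simp
qed

end
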